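(* Let $X$ be a finite set of design vectors, and suppose that the set of feasible design vectors $F=\{x\in X : c_k(x)\le 0\text{ for }1\le k\le K\}$ is not empty. Consider an infinite sequence of samples allocated sequentially by the cKG policy, and let $\mu_y^\infty$, $\mathrm{PF}^\infty$ and $\mathrm{cKG}^\infty$ be the limiting posterior mean, probability of feasibility and constrained Knowledge Gradient. If $\mathrm{cKG}^\infty(x)=0$ for all $x\in X$, then $$\arg\max_{x\in X}\mu_y^\infty(x)\,\mathrm{PF}^\infty(x)=\arg\max_{x\in X}f(x)\,\mathbb{I}_{x\in F},$$ where $\mathbb{I}_{x\in F}$ is $1$ if $x\in F$ and $0$ otherwise.
   Context: Setting. $X\subset\mathbb{R}^d$ is the design space, $f:X\to\mathbb{R}$ an unknown objective to be maximised, and $c_1,\dots,c_K:X\to\mathbb{R}$ unknown constraints; a design $x$ is feasible if $c_k(x)\le 0$ for all $k$. Infeasible designs are assigned utility $0$. Evaluating $x$ returns $y=f(x)+\epsilon$ with independent $\epsilon\sim N(0,\sigma_\epsilon^2)$, $\sigma_\epsilon^2\ge 0$, together with the constraint values $(c_1(x),\dots,c_K(x))$. Some initial data are collected before the sequential phase. Statistical model. $f$ and $c_1,\dots,c_K$ are modelled by mutually independent Gaussian processes, with prior means $\mu_y^0,\mu_k^0$ and prior covariance kernels $k_y^0,k_k^0$ (squared exponential, positive definite). After sampling $x_1,\dots,x_n$ (write $X_n=(x_1,\dots,x_n)$, $Y$ for the vector of observed objective values), $\mu_y^n$ and $k_y^n$ denote the posterior mean and covariance of the objective: $\mu_y^n(x)=\mu_y^0(x)+k_y^0(x,X_n)(k_y^0(X_n,X_n)+\sigma_\epsilon^2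 I)^{-1}(Y-\mu_y^0(X_n))$ and $k_y^n(x,x')=k_y^0(x,x')-k_y^0(x,X_n)(k_y^0(X_n,X_n)+\sigma_\epsilon^2 I)^{-1}k_y^0(X_n,x')$. Likewise $\mu_k^n,k_k^n$ are the posterior mean and covariance of $c_k$ given its observed (noise-free) values. (With noise-free repeated observations, these are understood as the conditional Gaussian mean and covariance.) Probability of feasibility. $\mathrm{PF}^n(x)=\prod_{k=1}^K\mathbb{P}[C_k\le 0]$ with $C_k\sim N(\mu_k^n(x),k_k^n(x,x))$ (a point mass if the variance is $0$). Recommended design. $x_r^n\in\arg\max_{x\in X}\mu_y^n(x)\,\mathrm{PF}^n(x)$. Acquisition function. For $x\in X$, $$\mathrm{cKG}^n(x)=\mathbb{E}\Big[\max_{x'\in X}\{\mu_y^{n+1}(x')\,\mathrm{PF}^{n+1}(x')\}-\mu_y^{n+1}(x_r^n)\,\mathrm{PF}^{n+1}(x_r^n)\,\Big|\,x^{n+1}=x\Big],$$ where the expectation is over the posterior predictive distribution (given the data at step $n$) of the observations $y^{n+1}$ and $c_1^{n+1},\dots,c_K^{n+1}$ at $x^{n+1}=x$. Equivalently, $\mu_y^{n+1}(x')=\mu_y^n(x')+\tilde\sigma_y^n(x',x)Z_y$, $\mu_k^{n+1}(x')=\mu_k^n(x')+\tilde\sigma_k^n(x',x)Z_k$, $k_k^{n+1}(x',x')=k_k^n(x',x')-\tilde\sigma_k^n(x',x)^2$, with $Z_y,Z_1,\dots,Z_K$ independent standard normal, $\tilde\sigma_y^n(x',x)=k_y^n(x',x)/\sqrt{k_y^n(x,x)+\sigma_\epsilon^2}$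 and $\tilde\sigma_k^n(x',x)=k_k^n(x',x)/\sqrt{k_k^n(x,x)}$ (read as $0$ when the denominator is $0$). cKG policy. At each step $n$, the next sample is $x^{n+1}\in\arg\max_{x\in X}\mathrm{cKG}^n(x)$. Limits. The pointwise limits $\mu_j^\infty=\lim_n\mu_j^n$ and $k_j^\infty=\lim_n k_j^n$, $j\in\{y,1,\dots,K\}$, exist almost surely. $\mathrm{PF}^\infty$ and $\mathrm{cKG}^\infty$ denote the quantities obtained from the definitions above when the posterior means and covariances at step $n$ are replaced by these limits (one-step updates being given by the displayed $Z$-parametrisation). *)

theory Defs
  imports "HOL-Probability.Probability"
begin

definition argmax_set :: "'a set \<Rightarrow> ('a \<Rightarrow> real) \<Rightarrow> 'a set" where
  "argmax_set S g = {x. is_arg_max g (\<lambda>y. y \<in> S) x}"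

text \<open>The normal distribution with mean m and variance v, including the degenerate case.\<close>

definition gauss :: "real \<Rightarrow> real \<Rightarrow> real measure" where
  "gauss m v = (if v = 0 then return borel m else density lborel (normal_density m (sqrt v)))"

definition sq_exp_kernel :: "(real ^ 'd \<Rightarrow> real ^ 'd \<Rightarrow> real) \<Rightarrow> bool" where
  "sq_exp_kernel \<kappa> \<longleftrightarrow> (\<exists>a > 0. \<exists>l. (\<forall>i. l $ i > 0) \<and>
     (\<forall>x x'. \<kappa> x x' = a\<^sup>2 * exp (- (1/2) * (\<Sum>i\<in>UNIV. ((x $ i - x' $ i) / l $ i)\<^sup>2))))"

definition pos_def_kernel :: "'a set \<Rightarrow> ('a \<Rightarrow> 'a \<Rightarrow> real) \<Rightarrow> bool" where
  "pos_def_kernel X \<kappa> \<longleftrightarrow> (\<forall>x\<in>X. \<forall>x'\<in>X. \<kappa> x x' = \<kappa> x' x) \<and>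
     (\<forall>u. (\<exists>x\<in>X. u x \<noteq> 0) \<longrightarrow> (\<Sum>x\<in>X. \<Sum>x'\<in>X. u x * u x' * \<kappa> x x') > 0)"

text \<open>
  Matrices of size n are functions of two indices below n, because n (the number of
  observations) varies. A generalised inverse of A is any G with A G A = A. It is the ordinary
  inverse if A is invertible (see the lemma below). For noise-free repeated observations the
  covariance matrix of the data is singular; replacing the inverse by a generalised inverse
  then gives the conditional mean and covariance of a degenerate Gaussian vector, which do not
  depend on the choice of G as long as the data are consistent (equal values at equal designs).
\<close>

definition is_gen_inv :: "nat \<Rightarrow> (nat \<Rightarrow> nat \<Rightarrow> real) \<Rightarrow> (nat \<Rightarrow> nat \<Rightarrow> real) \<Rightarrow> bool" where
  "is_gen_inv n A G \<longleftrightarrow>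
     (\<forall>i<n. \<forall>j<n. (\<Sum>p<n. \<Sum>q<n. A i p * G p q * A q j) = A i j)"

definition gen_inv :: "nat \<Rightarrow> (nat \<Rightarrow> nat \<Rightarrow> real) \<Rightarrow> nat \<Rightarrow> nat \<Rightarrow> real" where
  "gen_inv n A = (SOME G. is_gen_inv n A G)"

lemma gen_inv_eq_inverse:
  assumes AB: "\<And>i j. i < n \<Longrightarrow> j < n \<Longrightarrow> (\<Sum>p<n. A i p * B p j) = (if i = j then 1 else 0)"
    and BA: "\<And>i j. i < n \<Longrightarrow> j < n \<Longrightarrow> (\<Sum>p<n. B i p * A p j) = (if i = j then 1 else 0)"
    and "i < n" "j < n"
  shows "gen_inv n A i j = B i j"
proof -
  have cancel: "(\<Sum>r<n. \<Sum>s<n. B i r * (\<Sum>p<n. \<Sum>q<n. A r p * H p q * A q s) * B s j) = H i j"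
    if "i < n" "j < n" for H :: "nat \<Rightarrow> nat \<Rightarrow> real" and i j
  proof -
    have "(\<Sum>r<n. \<Sum>s<n. B i r * (\<Sum>p<n. \<Sum>q<n. A r p * H p q * A q s) * B s j)
        = (\<Sum>r<n. \<Sum>s<n. \<Sum>p<n. \<Sum>q<n. B i r * A r p * H p q * (A q s * B s j))"
      by (simp add: sum_distrib_left sum_distrib_right mult.assoc)
    also have "\<dots> = (\<Sum>r<n. \<Sum>p<n. \<Sum>s<n. \<Sum>q<n. B i r * A r p * H p q * (A q s * B s j))"
      by (intro sum.cong refl sum.swap)
    also have "\<dots> = (\<Sum>r<n. \<Sum>p<n. \<Sum>q<n. \<Sum>s<n. B i r * A r p * H p q * (A q s * B s j))"
      by (intro sum.cong refl sum.swap)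
    also have "\<dots> = (\<Sum>r<n. \<Sum>p<n. \<Sum>q<n. B i r * A r p * H p q * (\<Sum>s<n. A q s * B s j))"
      by (simp add: sum_distrib_left)
    also have "\<dots> = (\<Sum>r<n. \<Sum>p<n. B i r * A r p * H p j)"
      using that by (intro sum.cong refl) (simp add: AB if_distrib cong: if_cong)
    also have "\<dots> = (\<Sum>p<n. (\<Sum>r<n. B i r * A r p) * H p j)"
      by (subst sum.swap) (simp add: sum_distrib_right)
    also have "\<dots> = (\<Sum>p<n. if p = i then H p j else 0)"
      using that by (intro sum.cong refl) (auto simp: BA)
    also have "\<dots> = H i j"
      using that by simp
    finally show ?thesis .
  qed
  have "is_gen_inv n A B"
    unfolding is_gen_inv_def
  proof (intro allI impI)
    fix i j assume ij: "i < n" "j < n"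
    have "(\<Sum>p<n. \<Sum>q<n. A i p * B p q * A q j) = (\<Sum>q<n. (\<Sum>p<n. A i p * B p q) * A q j)"
      by (subst sum.swap) (simp add: sum_distrib_right)
    also have "\<dots> = (\<Sum>q<n. if q = i then A q j else 0)"
      using ij by (intro sum.cong refl) (auto simp: AB)
    finally show "(\<Sum>p<n. \<Sum>q<n. A i p * B p q * A q j) = A i j"
      using ij by simp
  qed
  note B = this
  have G: "is_gen_inv n A (gen_inv n A)"
    unfolding gen_inv_def by (rule someI[where P = "is_gen_inv n A", OF B])
  have "gen_inv n A i j = (\<Sum>r<n. \<Sum>s<n. B i r * A r s * B s j)"
    using G \<open>i < n\<close> \<open>j < n\<close> by (subst cancel[symmetric]) (auto simp: is_gen_inv_def)
  also have "\<dots> = B i j"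
    using B \<open>i < n\<close> \<open>j < n\<close> by (subst cancel[symmetric]) (auto simp: is_gen_inv_def)
  finally show ?thesis .
qed

text \<open>
  Gaussian process regression from the first n observations: designs xs 0, ..., xs (n-1) with
  values ys 0, ..., ys (n-1), prior mean m, prior kernel \<kappa>, and noise variance s2.
\<close>

definition post_weights :: "('a \<Rightarrow> 'a \<Rightarrow> real) \<Rightarrow> real \<Rightarrow> nat \<Rightarrow> (nat \<Rightarrow> 'a) \<Rightarrow> nat \<Rightarrow> nat \<Rightarrow> real" where
  "post_weights \<kappa> s2 n xs = gen_inv n (\<lambda>i j. \<kappa> (xs i) (xs j) + (if i = j then s2 else 0))"

definition post_mean ::
    "('a \<Rightarrow> real) \<Rightarrow> ('a \<Rightarrow> 'a \<Rightarrow> real) \<Rightarrow> real \<Rightarrow> nat \<Rightarrow> (nat \<Rightarrow> 'a) \<Rightarrow> (nat \<Rightarrow> real) \<Rightarrow> 'a \<Rightarrow> real" where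
  "post_mean m \<kappa> s2 n xs ys x =
     m x + (\<Sum>i<n. \<Sum>j<n. \<kappa> x (xs i) * post_weights \<kappa> s2 n xs i j * (ys j - m (xs j)))"

definition post_cov ::
    "('a \<Rightarrow> 'a \<Rightarrow> real) \<Rightarrow> real \<Rightarrow> nat \<Rightarrow> (nat \<Rightarrow> 'a) \<Rightarrow> 'a \<Rightarrow> 'a \<Rightarrow> real" where
  "post_cov \<kappa> s2 n xs x x' =
     \<kappa> x x' - (\<Sum>i<n. \<Sum>j<n. \<kappa> x (xs i) * post_weights \<kappa> s2 n xs i j * \<kappa> (xs j) x')"

text \<open>The constraints have indices 1, ..., K; m k and v k are the mean and variance functions
  of constraint k.\<close>

definition prob_feas :: "nat \<Rightarrow> (nat \<Rightarrow> 'a \<Rightarrow> real) \<Rightarrow> (nat \<Rightarrow> 'a \<Rightarrow> real) \<Rightarrow> 'a \<Rightarrow> real" where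
  "prob_feas K m v x = (\<Prod>k=1..K. measure (gauss (m k x) (v k x)) {..0})"

text \<open>Division by zero yields 0, which is the required convention here.\<close>

definition sigma_tilde :: "('a \<Rightarrow> 'a \<Rightarrow> real) \<Rightarrow> real \<Rightarrow> 'a \<Rightarrow> 'a \<Rightarrow> real" where
  "sigma_tilde \<kappa> s2 x' x = \<kappa> x' x / sqrt (\<kappa> x x + s2)"

text \<open>Utility of x' after one more sample at x, where the standardised predictive innovations
  of the objective and of the constraints are zy and zc.\<close>

definition next_value ::
    "nat \<Rightarrow> real \<Rightarrow> ('a \<Rightarrow> real) \<Rightarrow> ('a \<Rightarrow> 'a \<Rightarrow> real) \<Rightarrow> (nat \<Rightarrow> 'a \<Rightarrow> real) \<Rightarrow>
     (nat \<Rightarrow> 'a \<Rightarrow> 'a \<Rightarrow> real) \<Rightarrow> 'a \<Rightarrow> real \<Rightarrow> (nat \<Rightarrow> real) \<Rightarrow> 'a \<Rightarrow> real" where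
  "next_value K s2 \<mu>y \<kappa>y \<mu>c \<kappa>c x zy zc x' =
     (\<mu>y x' + sigma_tilde \<kappa>y s2 x' x * zy) *
     prob_feas K (\<lambda>k u. \<mu>c k u + sigma_tilde (\<kappa>c k) 0 u x * zc k)
                 (\<lambda>k u. \<kappa>c k u u - (sigma_tilde (\<kappa>c k) 0 u x)\<^sup>2) x'"

text \<open>
  The integration variable is the pair (zy, zc) of independent standard normal innovations;
  xr is the recommended design, passed explicitly because the maximiser need not be unique.
\<close>

definition cKG ::
    "'a set \<Rightarrow> nat \<Rightarrow> real \<Rightarrow> ('a \<Rightarrow> real) \<Rightarrow> ('a \<Rightarrow> 'a \<Rightarrow> real) \<Rightarrow> (nat \<Rightarrow> 'a \<Rightarrow> real) \<Rightarrow>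
     (nat \<Rightarrow> 'a \<Rightarrow> 'a \<Rightarrow> real) \<Rightarrow> 'a \<Rightarrow> 'a \<Rightarrow> real" where
  "cKG X K s2 \<mu>y \<kappa>y \<mu>c \<kappa>c xr x =
     (LINT z | (density lborel std_normal_density \<Otimes>\<^sub>M
                (\<Pi>\<^sub>M k\<in>{1..K}. density lborel std_normal_density)).
        Max (next_value K s2 \<mu>y \<kappa>y \<mu>c \<kappa>c x (fst z) (snd z) ` X)
        - next_value K s2 \<mu>y \<kappa>y \<mu>c \<kappa>c x (fst z) (snd z) xr)"

end

theory Submission
  imports Defs
begin

text \<open>
  After a sample at x, the utility of a design x' is affine in the innovation zy of the objective,
  with slope sigma(x', x) PF(x'), where PF is the updated probability of feasibility. If cKG(x) = 0,
  the recommended design is almost surely optimal for all zy, so for almost every constraint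
  innovation all these slopes agree. Since X is finite, some design s has been sampled so often that
  its posterior variance vanishes in the limit; its slope is 0, hence so is the slope of x itself. If
  the objective or a constraint were still uncertain at x, this would force the updated PF(x) to
  vanish almost surely. This is impossible if x has never been sampled, because then all its
  constraints hold after the update with positive probability. So every design has been sampled,
  its feasibility is known, and at every feasible x the variance of the objective vanishes in the
  limit and its posterior mean tends to f(x). The limiting utility is therefore f on F and 0
  elsewhere.

  The noise average at a design tends to 0 although the designs are chosen adaptively: this is a
  Chernoff bound for the exponential martingale stopped at the k-th visit, with Borel-Cantelli.
\<close>

section \<open>Generalised inverses\<close>

text \<open>Induction on the number of nonzero rows: subtracting the rank one matrix through a
  nonzero pivot clears the pivot row and creates no new nonzero row.\<close>

lemma gen_inv_exists:
  fixes A :: "'a \<Rightarrow> 'a \<Rightarrow> real"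
  assumes "finite I"
  shows "\<exists>G. \<forall>i\<in>I. \<forall>j\<in>I. (\<Sum>p\<in>I. \<Sum>q\<in>I. A i p * G p q * A q j) = A i j"
proof (induction "card {i\<in>I. \<exists>j\<in>I. A i j \<noteq> 0}" arbitrary: A rule: less_induct)
  case less
  show ?case
  proof (cases "\<exists>p\<in>I. \<exists>q\<in>I. A p q \<noteq> 0")
    case False
    then show ?thesis by (intro exI[of _ "\<lambda>_ _. 0"]) auto
  next
    case True
    then obtain p q where pq: "p \<in> I" "q \<in> I" "A p q \<noteq> 0" by blast
    define B where "B = (\<lambda>i j. A i j - A i q * A p j / A p q)"
    have "{i\<in>I. \<exists>j\<in>I. B i j \<noteq> 0} \<subset> {i\<in>I. \<exists>j\<in>I. A i j \<noteq> 0}"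
    proof
      show "{i\<in>I. \<exists>j\<in>I. B i j \<noteq> 0} \<subseteq> {i\<in>I. \<exists>j\<in>I. A i j \<noteq> 0}"
        using pq by (auto simp: B_def) (metis mult_eq_0_iff div_0)
      have "p \<in> {i\<in>I. \<exists>j\<in>I. A i j \<noteq> 0}" "p \<notin> {i\<in>I. \<exists>j\<in>I. B i j \<noteq> 0}"
        using pq by (auto simp: B_def)
      then show "{i\<in>I. \<exists>j\<in>I. B i j \<noteq> 0} \<noteq> {i\<in>I. \<exists>j\<in>I. A i j \<noteq> 0}" by blast
    qed
    then have "card {i\<in>I. \<exists>j\<in>I. B i j \<noteq> 0} < card {i\<in>I. \<exists>j\<in>I. A i j \<noteq> 0}"
      using assms by (intro psubset_card_mono) auto
    from less[OF this] obtain H where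
      H: "\<And>i j. i \<in> I \<Longrightarrow> j \<in> I \<Longrightarrow> (\<Sum>p\<in>I. \<Sum>q\<in>I. B i p * H p q * B q j) = B i j" by blast
    \<comment> \<open>Elimination matrices with A L = B and R A = B. Hence A (L H R) A = B H B = B,
      and the extra entry 1 / \<open>A p q\<close> of \<open>G\<close> at (q, p) restores the
      subtracted rank one matrix.\<close>
    define L where "L = (\<lambda>a c. (if a = c then 1 else 0) - (if a = q then A p c / A p q else 0))"
    define R where "R = (\<lambda>d b. (if d = b then 1 else 0) - (if b = p then A d q / A p q else 0))"
    define G where "G = (\<lambda>a b. (if a = q then if b = p then 1 / A p q else 0 else 0) +
      (\<Sum>c\<in>I. \<Sum>d\<in>I. L a c * H c d * R d b))"
    have AL: "(\<Sum>a\<in>I. A i a * L a c) = B i c" if "c \<in> I" for i c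
      using assms pq that
      by (simp add: L_def B_def right_diff_distrib sum_subtractf mult_delta_left mult_delta_right)
    have RA: "(\<Sum>b\<in>I. R d b * A b j) = B d j" if "d \<in> I" for d j
      using assms pq that
      by (simp add: R_def B_def left_diff_distrib sum_subtractf mult_delta_left mult_delta_right)
    show ?thesis
    proof (intro exI[of _ G] ballI)
      fix i j assume ij: "i \<in> I" "j \<in> I"
      have *: "(\<Sum>a\<in>I. \<Sum>b\<in>I. A i a * (\<Sum>c\<in>I. \<Sum>d\<in>I. L a c * H c d * R d b) * A b j) = B i j"
      proof -
        have "(\<Sum>a\<in>I. \<Sum>b\<in>I. A i a * (\<Sum>c\<in>I. \<Sum>d\<in>I. L a c * H c d * R d b) * A b j)
          = (\<Sum>a\<in>I. \<Sum>b\<in>I. \<Sum>c\<in>I. \<Sum>d\<in>I. A i a * L a c * H c d * (R d b * A b j))"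
          by (simp add: sum_distrib_left sum_distrib_right mult.assoc)
        also have "\<dots> = (\<Sum>a\<in>I. \<Sum>c\<in>I. \<Sum>b\<in>I. \<Sum>d\<in>I. A i a * L a c * H c d * (R d b * A b j))"
          by (intro sum.cong refl sum.swap)
        also have "\<dots> = (\<Sum>a\<in>I. \<Sum>c\<in>I. \<Sum>d\<in>I. \<Sum>b\<in>I. A i a * L a c * H c d * (R d b * A b j))"
          by (intro sum.cong refl sum.swap)
        also have "\<dots> = (\<Sum>a\<in>I. \<Sum>c\<in>I. \<Sum>d\<in>I. A i a * L a c * H c d * B d j)"
          by (simp add: sum_distrib_left[symmetric] RA)
        also have "\<dots> = (\<Sum>c\<in>I. \<Sum>a\<in>I. \<Sum>d\<in>I. A i a * L a c * H c d * B d j)"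
          by (rule sum.swap)
        also have "\<dots> = (\<Sum>c\<in>I. \<Sum>d\<in>I. \<Sum>a\<in>I. A i a * L a c * H c d * B d j)"
          by (intro sum.cong refl sum.swap)
        also have "\<dots> = (\<Sum>c\<in>I. \<Sum>d\<in>I. (\<Sum>a\<in>I. A i a * L a c) * H c d * B d j)"
          by (simp add: sum_distrib_right mult.assoc)
        also have "\<dots> = B i j"
          using ij by (simp add: AL H)
        finally show ?thesis .
      qed
      have "(\<Sum>a\<in>I. \<Sum>b\<in>I. A i a * G a b * A b j) =
        (\<Sum>a\<in>I. \<Sum>b\<in>I. (if a = q then if b = p then A i a * A b j / A p q else 0 else 0)
          + A i a * (\<Sum>c\<in>I. \<Sum>d\<in>I. L a c * H c d * R d b) * A b j)"
        by (intro sum.cong refl) (simp add: G_def ring_distribs)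
      also have "\<dots> = (\<Sum>a\<in>I. \<Sum>b\<in>I. (if a = q then if b = p then A i a * A b j / A p q else 0 else 0)) + B i j"
        by (simp add: sum.distrib *)
      also have "(\<Sum>a\<in>I. \<Sum>b\<in>I. (if a = q then if b = p then A i a * A b j / A p q else 0 else 0))
          = A i q * A p j / A p q"
      proof -
        have "(\<Sum>b\<in>I. (if a = q then if b = p then A i a * A b j / A p q else 0 else 0))
          = (if a = q then A i a * A p j / A p q else 0)" for a
          using assms pq by simp
        then show ?thesis using assms pq by simp
      qed
      finally show "(\<Sum>a\<in>I. \<Sum>b\<in>I. A i a * G a b * A b j) = A i j"
        by (simp add: B_def)
    qed
  qed
qed

text \<open>By A G A = A and symmetry, A annihilates e_i - G^T A e_i. As \<open>b\<close> is
  orthogonal to the kernel of A, pairing this vector with \<open>b\<close> gives the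
  equation.\<close>

lemma gen_inv_solves:
  fixes A :: "'a \<Rightarrow> 'a \<Rightarrow> real"
  assumes "finite I"
    and G: "\<And>i j. i \<in> I \<Longrightarrow> j \<in> I \<Longrightarrow> (\<Sum>p\<in>I. \<Sum>q\<in>I. A i p * G p q * A q j) = A i j"
    and sym: "\<And>i j. i \<in> I \<Longrightarrow> j \<in> I \<Longrightarrow> A i j = A j i"
    and orth: "\<And>u. (\<And>i. i \<in> I \<Longrightarrow> (\<Sum>j\<in>I. A i j * u j) = 0) \<Longrightarrow> (\<Sum>i\<in>I. u i * b i) = 0"
    and i: "i \<in> I"
  shows "(\<Sum>p\<in>I. A i p * (\<Sum>q\<in>I. G p q * b q)) = b i"
proof -
  define u where "u = (\<lambda>p. (if p = i then 1 else 0) - (\<Sum>q\<in>I. G q p * A q i))"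
  have "(\<Sum>p\<in>I. A j p * u p) = 0" if j: "j \<in> I" for j
  proof -
    have "(\<Sum>p\<in>I. A j p * u p) = A j i - (\<Sum>p\<in>I. \<Sum>q\<in>I. A j p * (G q p * A q i))"
      using assms(1) i by (simp add: u_def right_diff_distrib sum_subtractf sum_distrib_left mult_delta_left mult_delta_right)
    also have "(\<Sum>p\<in>I. \<Sum>q\<in>I. A j p * (G q p * A q i)) = (\<Sum>q\<in>I. \<Sum>p\<in>I. A i q * G q p * A p j)"
      using i j by (subst sum.swap) (intro sum.cong refl, simp add: sym mult_ac)
    also have "\<dots> = A i j" using G i j by blast
    finally show ?thesis using sym i j by simp
  qed
  from orth[OF this] have "0 = (\<Sum>p\<in>I. u p * b p)" by simp
  also have "\<dots> = b i - (\<Sum>p\<in>I. \<Sum>q\<in>I. G q p * A q i * b p)"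
    using assms(1) i by (simp add: u_def left_diff_distrib sum_subtractf sum_distrib_right mult_delta_left mult_delta_right)
  also have "(\<Sum>p\<in>I. \<Sum>q\<in>I. G q p * A q i * b p) = (\<Sum>q\<in>I. A i q * (\<Sum>p\<in>I. G q p * b p))"
    using i by (subst sum.swap) (simp add: sum_distrib_left sym[of i] mult_ac)
  finally show ?thesis by simp
qed

lemma square_le_of_quadratic_nonneg:
  fixes a b c :: real
  assumes "\<And>t. a + 2 * b * t + c * t\<^sup>2 \<ge> 0" and "c \<ge> 0"
  shows "b\<^sup>2 \<le> a * c"
proof (cases "c = 0")
  case True
  have "b = 0"
  proof (rule ccontr)
    assume "b \<noteq> 0"
    \<comment> \<open>The quadratic is linear here and takes the value -1 at this point.\<close>
    then show False using assms(1)[of "- (a + 1) / (2 * b)"] True by (simp add: field_simps)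
  qed
  then show ?thesis using True by simp
next
  case False
  then have "c > 0" using assms by simp
  then show ?thesis using assms(1)[of "- b / c"] by (simp add: field_simps power2_eq_square)
qed

section \<open>Gaussian process regression at finitely many designs\<close>

text \<open>One realised sequence of designs is fixed, so everything here is deterministic. The
  locale serves the objective with its noise variance and each constraint with
  \<open>s2 = 0\<close>.\<close>

locale gp_regression =
  fixes X :: "'a set" and \<kappa> :: "'a \<Rightarrow> 'a \<Rightarrow> real" and s2 :: real and xs :: "nat \<Rightarrow> 'a"
  assumes finite_X: "finite X" and pos_def: "pos_def_kernel X \<kappa>" and s2: "s2 \<ge> 0"
    and xs: "\<And>i. xs i \<in> X"
begin

text \<open>The prior covariance of two linear combinations, with coefficients u and v, of the
  values of the process on X.\<close>

definition form :: "('a \<Rightarrow> real) \<Rightarrow> ('a \<Rightarrow> real) \<Rightarrow> real" where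
  "form u v = (\<Sum>s\<in>X. \<Sum>t\<in>X. u s * v t * \<kappa> s t)"

text \<open>Repeated samples of a design act on the process only through their total weight, so
  weights per observation are collected into weights per design.\<close>

definition agg :: "nat \<Rightarrow> (nat \<Rightarrow> real) \<Rightarrow> 'a \<Rightarrow> real" where
  "agg n w t = (\<Sum>i | i < n \<and> xs i = t. w i)"

definition pdelta :: "'a \<Rightarrow> 'a \<Rightarrow> real" where
  "pdelta x t = (if t = x then 1 else 0)"

definition gram :: "nat \<Rightarrow> nat \<Rightarrow> real" where
  "gram i j = \<kappa> (xs i) (xs j) + (if i = j then s2 else 0)"

text \<open>The coefficients of the best linear predictor of the centred value at x; their
  optimality is \<open>post_cov_le_risk\<close>.\<close>

definition weights :: "nat \<Rightarrow> 'a \<Rightarrow> nat \<Rightarrow> real" where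
  "weights n x i = (\<Sum>j<n. post_weights \<kappa> s2 n xs i j * \<kappa> (xs j) x)"

definition resid :: "nat \<Rightarrow> 'a \<Rightarrow> 'a \<Rightarrow> real" where
  "resid n x t = pdelta x t - agg n (weights n x) t"

text \<open>The mean squared error of the linear predictor of the value at x with weights w.\<close>

definition risk :: "nat \<Rightarrow> 'a \<Rightarrow> (nat \<Rightarrow> real) \<Rightarrow> real" where
  "risk n x w = form (\<lambda>t. pdelta x t - agg n w t) (\<lambda>t. pdelta x t - agg n w t) + s2 * (\<Sum>i<n. (w i)\<^sup>2)"

section \<open>Algebra of the kernel form and of aggregated weights\<close>

lemma kernel_sym: "s \<in> X \<Longrightarrow> t \<in> X \<Longrightarrow> \<kappa> s t = \<kappa> t s"
  using pos_def unfolding pos_def_kernel_def by blast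

lemma form_pos: "x \<in> X \<Longrightarrow> u x \<noteq> 0 \<Longrightarrow> form u u > 0"
  using pos_def unfolding pos_def_kernel_def form_def by blast

lemma form_nonneg: "form u u \<ge> 0"
proof (cases "\<exists>x\<in>X. u x \<noteq> 0")
  case True
  then show ?thesis using form_pos less_imp_le by blast
next
  case False
  then show ?thesis by (simp add: form_def)
qed

lemma form_sym: "form u v = form v u"
  unfolding form_def by (subst sum.swap) (intro sum.cong refl, simp add: kernel_sym)

lemma form_eq_sum: "form u v = (\<Sum>s\<in>X. u s * (\<Sum>t\<in>X. \<kappa> s t * v t))"
  by (simp add: form_def sum_distrib_left mult_ac)

lemma form_add_left: "form (\<lambda>t. u t + v t) w = form u w + form v w"
  by (simp add: form_def ring_distribs sum.distrib)

lemma form_diff_left: "form (\<lambda>t. u t - v t) w = form u w - form v w"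
  by (simp add: form_def ring_distribs sum_subtractf)

lemma form_scale_left: "form (\<lambda>t. a * u t) w = a * form u w"
  by (simp add: form_def sum_distrib_left mult_ac)

lemma form_diff_square:
  "form (\<lambda>t. u t - v t) (\<lambda>t. u t - v t) = form u u - 2 * form u v + form v v"
  by (simp add: form_diff_left form_sym[of _ "\<lambda>t. u t - v t"] form_sym[of v u])

lemma form_pdelta: "x \<in> X \<Longrightarrow> form (pdelta x) v = (\<Sum>t\<in>X. \<kappa> x t * v t)"
  using finite_X by (simp add: form_eq_sum pdelta_def mult_delta_left)

lemma sum_eq_agg: "(\<Sum>i<n. w i * g (xs i)) = (\<Sum>t\<in>X. agg n w t * g t)"
proof -
  have "(\<Sum>t\<in>X. agg n w t * g t) = (\<Sum>t\<in>X. \<Sum>i | i \<in> {..<n} \<and> xs i = t. w i * g (xs i))"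
    by (simp add: agg_def sum_distrib_right)
  also have "\<dots> = (\<Sum>i<n. w i * g (xs i))"
    by (rule sum.group) (use xs finite_X in auto)
  finally show ?thesis ..
qed

lemma form_agg: "form (agg n w) v = (\<Sum>i<n. w i * (\<Sum>t\<in>X. \<kappa> (xs i) t * v t))"
  unfolding form_eq_sum by (rule sum_eq_agg[symmetric])

lemma agg_diff: "agg n (\<lambda>i. v i - w i) t = agg n v t - agg n w t"
  by (simp add: agg_def sum_subtractf)

section \<open>The Gram matrix and the normal equations\<close>

lemma gram_apply:
  assumes "i < n"
  shows "(\<Sum>j<n. gram i j * w j) = (\<Sum>t\<in>X. \<kappa> (xs i) t * agg n w t) + s2 * w i"
proof -
  have "(\<Sum>j<n. gram i j * w j) = (\<Sum>j<n. w j * \<kappa> (xs i) (xs j)) + s2 * w i"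
    using assms by (simp add: gram_def ring_distribs sum.distrib mult_delta_left mult_delta_right mult_ac)
  then show ?thesis by (simp add: sum_eq_agg mult_ac)
qed

text \<open>Pairing the image of \<open>u\<close> with \<open>u\<close> gives the kernel form of
  \<open>agg n u\<close> plus \<open>s2\<close> times the squared norm of \<open>u\<close>; both are
  nonnegative, so both vanish. Without noise only the total weight at each design is forced to be 0,
  since designs may repeat.\<close>

lemma gram_kernel_trivial:
  assumes "\<And>i. i < n \<Longrightarrow> (\<Sum>j<n. gram i j * u j) = 0"
  shows "t \<in> X \<Longrightarrow> agg n u t = 0" and "s2 > 0 \<Longrightarrow> i < n \<Longrightarrow> u i = 0"
proof -
  have "0 = (\<Sum>i<n. u i * (\<Sum>j<n. gram i j * u j))" using assms by simp
  also have "\<dots> = (\<Sum>i<n. u i * (\<Sum>t\<in>X. \<kappa> (xs i) t * agg n u t) + s2 * (u i)\<^sup>2)"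
    by (intro sum.cong refl) (simp add: gram_apply distrib_left power2_eq_square)
  also have "\<dots> = (\<Sum>i<n. u i * (\<Sum>t\<in>X. \<kappa> (xs i) t * agg n u t)) + s2 * (\<Sum>i<n. (u i)\<^sup>2)"
    by (simp add: sum.distrib sum_distrib_left)
  finally have eq: "form (agg n u) (agg n u) + s2 * (\<Sum>i<n. (u i)\<^sup>2) = 0"
    by (simp add: form_agg)
  have nn: "s2 * (\<Sum>i<n. (u i)\<^sup>2) \<ge> 0" using s2 by (simp add: sum_nonneg)
  show "t \<in> X \<Longrightarrow> agg n u t = 0"
    using eq nn form_pos[of t "agg n u"] by force
  show "u i = 0" if "s2 > 0" "i < n"
  proof -
    have "(\<Sum>i<n. (u i)\<^sup>2) = 0"
      using eq form_nonneg[of "agg n u"] nn that by (smt (verit) mult_eq_0_iff)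
    then show ?thesis using that by (subst (asm) sum_nonneg_eq_0_iff) auto
  qed
qed

text \<open>A vector of values of a function at the designs is orthogonal to the kernel of the Gram
  matrix; so is every vector if there is noise. On such vectors the generalised inverse acts as
  an inverse.\<close>

lemma post_weights_solve:
  assumes "(\<forall>i<n. b i = g (xs i)) \<or> s2 > 0" "i < n"
  shows "(\<Sum>p<n. gram i p * (\<Sum>q<n. post_weights \<kappa> s2 n xs p q * b q)) = b i"
proof (rule gen_inv_solves)
  have "\<exists>G. is_gen_inv n gram G"
    using gen_inv_exists[of "{..<n}" gram] by (auto simp: is_gen_inv_def)
  then have "is_gen_inv n gram (gen_inv n gram)"
    unfolding gen_inv_def by (rule someI_ex)
  then have "is_gen_inv n gram (post_weights \<kappa> s2 n xs)"
    by (simp add: post_weights_def gram_def[abs_def])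
  then show "(\<Sum>p<n. \<Sum>q<n. gram i p * post_weights \<kappa> s2 n xs p q * gram q j) = gram i j"
    if "i \<in> {..<n}" "j \<in> {..<n}" for i j
    using that by (simp add: is_gen_inv_def)
  show "gram i j = gram j i" for i j
    by (simp add: gram_def kernel_sym xs)
  show "(\<Sum>i<n. u i * b i) = 0" if "\<And>i. i \<in> {..<n} \<Longrightarrow> (\<Sum>j<n. gram i j * u j) = 0" for u
    using assms(1)
  proof
    assume "\<forall>i<n. b i = g (xs i)"
    then have "(\<Sum>i<n. u i * b i) = (\<Sum>i<n. u i * g (xs i))" by simp
    also have "\<dots> = 0"
      using gram_kernel_trivial(1)[of n u] that by (simp add: sum_eq_agg)
    finally show ?thesis .
  next
    assume "s2 > 0"
    then show ?thesis using gram_kernel_trivial(2)[of n u] that by simp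
  qed
qed (use assms in auto)

lemma weights_solve:
  assumes "i < n" "x \<in> X"
  shows "(\<Sum>j<n. gram i j * weights n x j) = \<kappa> (xs i) x"
  unfolding weights_def by (rule post_weights_solve[of n _ "\<lambda>t. \<kappa> t x"]) (use assms in auto)

text \<open>The normal equations: the prediction error is uncorrelated with every observation, the
  right-hand side being the contribution of the noise.\<close>

lemma resid_normal:
  assumes "i < n" "x \<in> X"
  shows "(\<Sum>t\<in>X. \<kappa> (xs i) t * resid n x t) = s2 * weights n x i"
  using weights_solve[OF assms] gram_apply[OF assms(1), of "weights n x"] finite_X assms
  by (simp add: resid_def right_diff_distrib sum_subtractf pdelta_def mult_delta_right)

text \<open>Exhibits the posterior covariance as the covariance of two prediction errors.
  \<open>pdelta x\<close> splits into residual and predictor, and the normal equations evaluate the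
  predictor part.\<close>

lemma post_cov_eq:
  assumes "x \<in> X" "x' \<in> X"
  shows "post_cov \<kappa> s2 n xs x x' =
    form (resid n x) (resid n x') + s2 * (\<Sum>i<n. weights n x i * weights n x' i)"
proof -
  have "post_cov \<kappa> s2 n xs x x' = \<kappa> x x' - (\<Sum>i<n. weights n x' i * \<kappa> x (xs i))"
    by (simp add: post_cov_def weights_def sum_distrib_left sum_distrib_right mult_ac)
  also have "(\<Sum>i<n. weights n x' i * \<kappa> x (xs i)) = (\<Sum>t\<in>X. agg n (weights n x') t * \<kappa> x t)"
    by (rule sum_eq_agg)
  also have "\<kappa> x x' - \<dots> = form (pdelta x) (resid n x')"
    using finite_X assms
    by (simp add: form_pdelta resid_def right_diff_distrib sum_subtractf pdelta_def mult_delta_right mult_ac)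
  also have "\<dots> = form (resid n x) (resid n x') + form (agg n (weights n x)) (resid n x')"
    by (simp add: form_add_left[symmetric] resid_def)
  also have "form (agg n (weights n x)) (resid n x') = s2 * (\<Sum>i<n. weights n x i * weights n x' i)"
    using assms by (simp add: form_agg resid_normal sum_distrib_left mult_ac)
  finally show ?thesis .
qed

lemma post_cov_diag_eq_risk:
  "x \<in> X \<Longrightarrow> post_cov \<kappa> s2 n xs x x = risk n x (weights n x)"
  by (simp add: post_cov_eq risk_def resid_def[abs_def] power2_eq_square)

lemma risk_nonneg: "risk n x w \<ge> 0"
  using s2 by (simp add: risk_def form_nonneg sum_nonneg)

text \<open>When the risk is expanded around \<open>weights n x\<close>, the cross terms cancel by
  the normal equations and only squares remain. Any explicit choice of weights thus bounds the
  posterior variance from above.\<close>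

lemma post_cov_le_risk:
  assumes "x \<in> X"
  shows "post_cov \<kappa> s2 n xs x x \<le> risk n x w"
proof -
  define d where "d = (\<lambda>i. w i - weights n x i)"
  have w: "w i = weights n x i + d i" for i by (simp add: d_def)
  have "pdelta x t - agg n w t = resid n x t - agg n d t" for t
    by (simp add: d_def agg_diff resid_def)
  then have "risk n x w = form (resid n x) (resid n x) - 2 * form (agg n d) (resid n x) + form (agg n d) (agg n d)
      + s2 * (\<Sum>i<n. (w i)\<^sup>2)"
    by (simp add: risk_def form_diff_square form_sym[of "agg n d" "resid n x"])
  also have "form (agg n d) (resid n x) = s2 * (\<Sum>i<n. d i * weights n x i)"
    using assms by (simp add: form_agg resid_normal sum_distrib_left mult_ac)
  also have "s2 * (\<Sum>i<n. (w i)\<^sup>2) = s2 * (\<Sum>i<n. weights n x i * weights n x i)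
      + 2 * (s2 * (\<Sum>i<n. d i * weights n x i)) + s2 * (\<Sum>i<n. (d i)\<^sup>2)"
    by (simp add: w power2_eq_square ring_distribs sum.distrib mult_ac sum_distrib_left)
  finally have "risk n x w = post_cov \<kappa> s2 n xs x x + form (agg n d) (agg n d) + s2 * (\<Sum>i<n. (d i)\<^sup>2)"
    using assms by (simp add: post_cov_eq)
  moreover have "s2 * (\<Sum>i<n. (d i)\<^sup>2) \<ge> 0" using s2 by (simp add: sum_nonneg)
  ultimately show ?thesis using form_nonneg[of "agg n d"] by linarith
qed

lemma post_cov_diag_nonneg: "x \<in> X \<Longrightarrow> post_cov \<kappa> s2 n xs x x \<ge> 0"
  by (simp add: post_cov_diag_eq_risk risk_nonneg)

lemma post_cov_diag_decseq:
  assumes "x \<in> X"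
  shows "decseq (\<lambda>n. post_cov \<kappa> s2 n xs x x)"
proof (rule decseq_SucI)
  fix n
  \<comment> \<open>The old weights padded by 0 ignore the new observation and keep the same
    risk.\<close>
  define w where "w = (\<lambda>i. if i < n then weights n x i else 0)"
  have "agg (Suc n) w t = agg n (weights n x) t" for t
    unfolding agg_def by (rule sum.mono_neutral_cong_right) (auto simp: w_def)
  then have "risk (Suc n) x w = risk n x (weights n x)"
    by (simp add: risk_def w_def)
  then show "post_cov \<kappa> s2 (Suc n) xs x x \<le> post_cov \<kappa> s2 n xs x x"
    using post_cov_le_risk[OF assms, of "Suc n" w] assms by (simp add: post_cov_diag_eq_risk)
qed

lemma post_cov_cauchy_schwarz:
  assumes "x \<in> X" "x' \<in> X"
  shows "(post_cov \<kappa> s2 n xs x x')\<^sup>2 \<le> post_cov \<kappa> s2 n xs x x * post_cov \<kappa> s2 n xs x' x'"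
proof (rule square_le_of_quadratic_nonneg)
  fix t
  let ?r = "\<lambda>s. resid n x s + t * resid n x' s"
  let ?w = "\<lambda>i. weights n x i + t * weights n x' i"
  have "0 \<le> form ?r ?r + s2 * (\<Sum>i<n. (?w i)\<^sup>2)"
    using s2 by (simp add: form_nonneg sum_nonneg)
  also have "form ?r ?r = form (resid n x) (resid n x) + 2 * t * form (resid n x) (resid n x') + t\<^sup>2 * form (resid n x') (resid n x')"
    by (simp add: form_add_left form_scale_left form_sym[of _ ?r] form_sym[of "resid n x'" "resid n x"]
        power2_eq_square ring_distribs)
  also have "(\<Sum>i<n. (?w i)\<^sup>2) = (\<Sum>i<n. weights n x i * weights n x i) + 2 * t * (\<Sum>i<n. weights n x i * weights n x' i)
      + t\<^sup>2 * (\<Sum>i<n. weights n x' i * weights n x' i)"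
    by (simp add: power2_eq_square ring_distribs sum.distrib sum_distrib_left mult_ac)
  finally show "0 \<le> post_cov \<kappa> s2 n xs x x + 2 * post_cov \<kappa> s2 n xs x x' * t + post_cov \<kappa> s2 n xs x' x' * t\<^sup>2"
    using assms by (simp add: post_cov_eq ring_distribs mult_ac)
qed (simp add: post_cov_diag_nonneg assms)

section \<open>Coercivity of the kernel form and the error of the posterior mean\<close>

lemma form_cauchy_schwarz: "(form u v)\<^sup>2 \<le> form u u * form v v"
proof (rule square_le_of_quadratic_nonneg)
  fix t
  let ?r = "\<lambda>s. u s + t * v s"
  have "0 \<le> form ?r ?r" by (rule form_nonneg)
  also have "form ?r ?r = form u u + 2 * form u v * t + form v v * t\<^sup>2"
    by (simp add: form_add_left form_scale_left form_sym[of _ ?r] form_sym[of v u]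
        power2_eq_square ring_distribs)
  finally show "0 \<le> form u u + 2 * form u v * t + form v v * t\<^sup>2" .
qed (rule form_nonneg)

text \<open>The kernel matrix on X is invertible; let \<open>w\<close> be the column of its inverse
  at x. Then \<open>form u w = u x\<close>, and Cauchy-Schwarz yields the constant
  \<open>1 / form w w\<close>.\<close>

lemma form_coercive:
  assumes x: "x \<in> X"
  shows "\<exists>l>0. \<forall>u. form u u \<ge> l * (u x)\<^sup>2"
proof -
  obtain G where G: "\<And>i j. i \<in> X \<Longrightarrow> j \<in> X \<Longrightarrow> (\<Sum>p\<in>X. \<Sum>q\<in>X. \<kappa> i p * G p q * \<kappa> q j) = \<kappa> i j"
    using gen_inv_exists[OF finite_X, of \<kappa>] by blast
  define w where "w = (\<lambda>p. \<Sum>q\<in>X. G p q * pdelta x q)"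
  have w: "(\<Sum>t\<in>X. \<kappa> s t * w t) = pdelta x s" if "s \<in> X" for s
    unfolding w_def
  proof (rule gen_inv_solves[OF finite_X G])
    fix u :: "'a \<Rightarrow> real" assume "\<And>i. i \<in> X \<Longrightarrow> (\<Sum>j\<in>X. \<kappa> i j * u j) = 0"
    then have "form u u = 0" by (simp add: form_eq_sum)
    then have "u i = 0" if "i \<in> X" for i using form_pos[OF that, of u] by force
    then show "(\<Sum>i\<in>X. u i * pdelta x i) = 0" by simp
  qed (use that kernel_sym in auto)
  have form_w: "form u w = u x" for u
    using finite_X x by (simp add: form_eq_sum w pdelta_def mult_delta_right)
  have "form w w > 0"
  proof -
    have "\<exists>t\<in>X. w t \<noteq> 0"
    proof (rule ccontr)
      assume "\<not> ?thesis"
      then have "(\<Sum>t\<in>X. \<kappa> x t * w t) = 0" by simp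
      then show False using w[OF x] by (simp add: pdelta_def)
    qed
    then show ?thesis using form_pos by blast
  qed
  moreover have "(u x)\<^sup>2 \<le> form u u * form w w" for u
    using form_cauchy_schwarz[of u w] by (simp add: form_w)
  ultimately show ?thesis
    by (intro exI[of _ "1 / form w w"]) (simp add: field_simps)
qed

text \<open>Separates the weighted noise from the bias, which the residual controls. With
  \<open>s2 = 0\<close> the noise has to vanish so that repeated samples carry equal values.\<close>

lemma post_mean_error:
  assumes "x \<in> X" and noise: "s2 = 0 \<Longrightarrow> \<forall>i<n. \<epsilon> i = 0"
  shows "post_mean m \<kappa> s2 n xs (\<lambda>i. f (xs i) + \<epsilon> i) x - f x =
    (\<Sum>i<n. weights n x i * \<epsilon> i) - (\<Sum>t\<in>X. resid n x t * (f t - m t))"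
proof -
  define d where "d = (\<lambda>j. f (xs j) + \<epsilon> j - m (xs j))"
  define v where "v = (\<lambda>i. \<Sum>j<n. post_weights \<kappa> s2 n xs i j * d j)"
  have v: "(\<Sum>p<n. gram i p * v p) = d i" if "i < n" for i
    unfolding v_def
    by (rule post_weights_solve[of n d "\<lambda>t. f t - m t"]) (use that noise s2 in \<open>auto simp: d_def\<close>)
  have "post_mean m \<kappa> s2 n xs (\<lambda>i. f (xs i) + \<epsilon> i) x - m x = (\<Sum>i<n. \<kappa> (xs i) x * v i)"
    using assms xs by (simp add: post_mean_def v_def d_def sum_distrib_left mult_ac kernel_sym[of x])
  \<comment> \<open>Symmetry of the Gram matrix moves the linear system from \<open>weights\<close>
    to \<open>v\<close>, that is, from the kernel column to the data.\<close>
  also have "\<dots> = (\<Sum>i<n. \<Sum>j<n. gram i j * weights n x j * v i)"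
    using assms by (simp add: weights_solve[symmetric] sum_distrib_right)
  also have "\<dots> = (\<Sum>j<n. weights n x j * (\<Sum>i<n. gram j i * v i))"
    by (subst sum.swap) (simp add: sum_distrib_left mult_ac gram_def kernel_sym xs eq_commute)
  also have "\<dots> = (\<Sum>j<n. weights n x j * d j)" by (simp add: v)
  also have "\<dots> = (\<Sum>j<n. weights n x j * (f (xs j) - m (xs j))) + (\<Sum>i<n. weights n x i * \<epsilon> i)"
    by (simp add: d_def ring_distribs sum.distrib[symmetric] algebra_simps)
  also have "(\<Sum>j<n. weights n x j * (f (xs j) - m (xs j))) = (\<Sum>t\<in>X. agg n (weights n x) t * (f t - m t))"
    by (rule sum_eq_agg)
  also have "\<dots> = (f x - m x) - (\<Sum>t\<in>X. resid n x t * (f t - m t))"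
    using finite_X assms(1)
    by (simp add: resid_def left_diff_distrib[where c = "f _ - m _"] sum_subtractf pdelta_def mult_delta_left)
  finally show ?thesis by simp
qed

end

section \<open>Limits of the posterior\<close>

definition visits :: "(nat \<Rightarrow> 'a) \<Rightarrow> nat \<Rightarrow> 'a \<Rightarrow> nat" where
  "visits xs n t = card {i. i < n \<and> xs i = t}"

lemma visits_at_top:
  assumes "infinite {i. xs i = t}"
  shows "filterlim (\<lambda>n. visits xs n t) at_top sequentially"
  unfolding filterlim_at_top
proof
  fix Z
  obtain B where B: "finite B" "card B = Z" "B \<subseteq> {i. xs i = t}"
    using infinite_arbitrarily_large[OF assms] by blast
  have "Z \<le> visits xs n t" if "n > Max B" for n
  proof -
    have "B \<subseteq> {i. i < n \<and> xs i = t}"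
      using B that by (auto dest: Max_ge[OF B(1)])
    then show ?thesis unfolding visits_def B(2)[symmetric] by (rule card_mono[rotated]) simp
  qed
  then show "\<forall>\<^sub>F n in sequentially. Z \<le> visits xs n t"
    by (rule eventually_mono[OF eventually_gt_at_top[of "Max B"]])
qed

context gp_regression
begin

text \<open>The designs at which the posterior variance of the process vanishes in the limit.\<close>

definition known :: "'a \<Rightarrow> bool" where
  "known x \<longleftrightarrow> (if s2 = 0 then \<exists>i. xs i = x else infinite {i. xs i = x})"

lemma known_noise_free: "s2 = 0 \<Longrightarrow> known x \<longleftrightarrow> (\<exists>i. xs i = x)"
  unfolding known_def by simp

lemma known_noisy: "s2 \<noteq> 0 \<Longrightarrow> known x \<longleftrightarrow> infinite {i. xs i = x}"
  unfolding known_def by simp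

text \<open>With noise, finitely many designs share infinitely many samples; without noise, a single
  sample suffices.\<close>

lemma exists_known: "\<exists>x\<in>X. known x"
proof (cases "s2 = 0")
  case True
  then show ?thesis using xs[of 0] known_noise_free by blast
next
  case False
  have "\<exists>x\<in>X. infinite {i \<in> UNIV. xs i = x}"
    by (rule pigeonhole_infinite_rel) (use finite_X xs in auto)
  then show ?thesis using known_noisy[OF False] by auto
qed

text \<open>The average of the samples at x is an unbiased predictor with exactly this risk.\<close>

lemma post_cov_diag_le:
  assumes "x \<in> X" "visits xs n x > 0"
  shows "post_cov \<kappa> s2 n xs x x \<le> s2 / visits xs n x"
proof -
  define w where "w = (\<lambda>i. if xs i = x then 1 / real (visits xs n x) else 0)"
  have "agg n w t = pdelta x t" for t
  proof -
    have "agg n w t = (\<Sum>i | i < n \<and> xs i = t. if t = x then 1 / real (visits xs n x) else 0)"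
      unfolding agg_def by (rule sum.cong) (auto simp: w_def)
    then have "agg n w t = real (visits xs n t) * (if t = x then 1 / real (visits xs n x) else 0)"
      by (simp only: sum_constant visits_def)
    then show ?thesis using assms(2) by (simp add: pdelta_def)
  qed
  moreover have "(\<Sum>i<n. (w i)\<^sup>2) = 1 / visits xs n x"
  proof -
    have "(\<Sum>i<n. (w i)\<^sup>2) = (\<Sum>i | i < n \<and> xs i = x. (1 / real (visits xs n x))\<^sup>2)"
      by (rule sum.mono_neutral_cong_right) (auto simp: w_def)
    then show ?thesis by (simp add: visits_def[symmetric] power2_eq_square)
  qed
  ultimately have "risk n x w = s2 / visits xs n x"
    by (simp add: risk_def form_def)
  then show ?thesis using post_cov_le_risk[OF assms(1), of n w] by simp
qed

lemma post_cov_diag_tendsto_0: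
  assumes "x \<in> X" "known x"
  shows "(\<lambda>n. post_cov \<kappa> s2 n xs x x) \<longlonglongrightarrow> 0"
proof (rule real_tendsto_sandwich[where f = "\<lambda>_. 0"])
  have ev: "\<forall>\<^sub>F n in sequentially. visits xs n x > 0"
  proof (cases "s2 = 0")
    case True
    then obtain i where i: "xs i = x" using assms known_noise_free by blast
    have "visits xs n x > 0" if "n > i" for n
      unfolding visits_def using that i by (subst card_gt_0_iff) auto
    then show ?thesis by (rule eventually_mono[OF eventually_gt_at_top[of i]])
  next
    case False
    then have "filterlim (\<lambda>n. visits xs n x) at_top sequentially"
      using assms by (intro visits_at_top) (simp add: known_def)
    then show ?thesis using eventually_compose_filterlim[OF eventually_gt_at_top[of 0]] by blast
  qed
  then show "\<forall>\<^sub>F n in sequentially. post_cov \<kappa> s2 n xs x x \<le> s2 / visits xs n x"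
    by eventually_elim (rule post_cov_diag_le[OF assms(1)])
  show "(\<lambda>n. s2 / visits xs n x) \<longlonglongrightarrow> 0"
  proof (cases "s2 = 0")
    case False
    then have "filterlim (\<lambda>n. visits xs n x) at_top sequentially"
      using assms by (intro visits_at_top) (simp add: known_def)
    then have "filterlim (\<lambda>n. real (visits xs n x)) at_top sequentially"
      by (rule filterlim_compose[OF filterlim_real_sequentially])
    then show ?thesis by (intro tendsto_divide_0[OF tendsto_const] filterlim_at_top_imp_at_infinity)
  qed simp
qed (auto simp: post_cov_diag_nonneg assms)

text \<open>Cauchy-Schwarz for the posterior covariance; by monotonicity the variance at x' stays
  below \<open>?C\<close>, its value before any data.\<close>

lemma post_cov_tendsto_0:
  assumes x: "x \<in> X" "known x" and x': "x' \<in> X"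
  shows "(\<lambda>n. post_cov \<kappa> s2 n xs x x') \<longlonglongrightarrow> 0"
proof -
  let ?C = "post_cov \<kappa> s2 0 xs x' x'"
  have "(\<lambda>n. (post_cov \<kappa> s2 n xs x x')\<^sup>2) \<longlonglongrightarrow> 0"
  proof (rule real_tendsto_sandwich[where f = "\<lambda>_. 0"])
    show "(\<lambda>n. post_cov \<kappa> s2 n xs x x * ?C) \<longlonglongrightarrow> 0"
      using post_cov_diag_tendsto_0[OF x] by (rule tendsto_mult_left_zero)
    have "(post_cov \<kappa> s2 n xs x x')\<^sup>2 \<le> post_cov \<kappa> s2 n xs x x * ?C" for n
      by (rule order_trans[OF post_cov_cauchy_schwarz[OF x(1) x']
            mult_left_mono[OF decseqD[OF post_cov_diag_decseq[OF x'] le0] post_cov_diag_nonneg[OF x(1)]]])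
    then show "\<forall>\<^sub>F n in sequentially. (post_cov \<kappa> s2 n xs x x')\<^sup>2 \<le> post_cov \<kappa> s2 n xs x x * ?C"
      by simp
  qed auto
  then have "(\<lambda>n. sqrt ((post_cov \<kappa> s2 n xs x x')\<^sup>2)) \<longlonglongrightarrow> sqrt 0"
    by (rule tendsto_real_sqrt)
  then show ?thesis by (simp add: tendsto_rabs_zero_iff)
qed

section \<open>Designs that stay uncertain in the limit\<close>

lemma agg_square_le:
  "(agg n w t)\<^sup>2 \<le> (\<Sum>i<n. (w i)\<^sup>2) * visits xs n t"
proof -
  have "(agg n w t)\<^sup>2 \<le> (\<Sum>i | i < n \<and> xs i = t. (w i)\<^sup>2) * visits xs n t"
    unfolding agg_def visits_def by (rule sum_squared_le_sum_of_squares)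
  also have "\<dots> \<le> (\<Sum>i<n. (w i)\<^sup>2) * visits xs n t"
    by (intro mult_right_mono sum_mono2) auto
  finally show ?thesis .
qed

text \<open>A predictor with total weight U on at most N samples of x pays l (1 - U)^2 through its
  residual at x and at least s2 U^2 / N through the noise, and these cannot both be small. Without
  noise an unknown x has no samples, so U = 0.\<close>

lemma post_cov_diag_lower_bound:
  assumes x: "x \<in> X" and not_known: "\<not> known x"
  shows "\<exists>d>0. \<forall>n. post_cov \<kappa> s2 n xs x x \<ge> d"
proof -
  obtain l where l: "l > 0" "\<And>u. form u u \<ge> l * (u x)\<^sup>2"
    using form_coercive[OF x] by blast
  have V: "post_cov \<kappa> s2 n xs x x \<ge> l * (1 - agg n (weights n x) x)\<^sup>2 + s2 * (\<Sum>i<n. (weights n x i)\<^sup>2)" for n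
    using l(2)[of "resid n x"] x by (simp add: post_cov_eq resid_def pdelta_def power2_eq_square)
  show ?thesis
  proof (cases "s2 = 0")
    case True
    then have "{i. i < n \<and> xs i = x} = {}" for n
      using not_known known_noise_free by blast
    then have "agg n (weights n x) x = 0" for n
      unfolding agg_def by (simp only: sum.empty)
    then show ?thesis using V True l by auto
  next
    case False
    then have s2p: "s2 > 0" using s2 by simp
    \<comment> \<open>The added 1 keeps \<open>N\<close> positive when x is never sampled.\<close>
    define N where "N = card {i. xs i = x} + 1"
    have fin: "finite {i. xs i = x}" using not_known False by (simp add: known_def)
    have visits: "visits xs n x \<le> N" for n
    proof -
      have "visits xs n x \<le> card {i. xs i = x}"
        unfolding visits_def by (rule card_mono[OF fin]) auto
      then show ?thesis by (simp add: N_def)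
    qed
    define d where "d = min l (s2 / N)"
    have d: "d > 0" using l s2p by (simp add: d_def N_def)
    have "post_cov \<kappa> s2 n xs x x \<ge> d / 2" for n
    proof -
      let ?U = "agg n (weights n x) x" and ?W = "\<Sum>i<n. (weights n x i)\<^sup>2"
      have "?W * visits xs n x \<le> ?W * N"
        using visits[of n] by (intro mult_left_mono sum_nonneg) auto
      with agg_square_le[of n "weights n x" x] have "?U\<^sup>2 \<le> ?W * N" by linarith
      then have "(s2 / N) * ?U\<^sup>2 \<le> (s2 / N) * (?W * N)"
        using s2p by (intro mult_left_mono) auto
      then have "(s2 / N) * ?U\<^sup>2 \<le> s2 * ?W" by (simp add: N_def)
      moreover have "d * ?U\<^sup>2 \<le> (s2 / N) * ?U\<^sup>2" "d * (1 - ?U)\<^sup>2 \<le> l * (1 - ?U)\<^sup>2"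
        by (rule mult_right_mono, simp_all add: d_def)+
      moreover have "d * (1 / 2) \<le> d * ((1 - ?U)\<^sup>2 + ?U\<^sup>2)"
      proof (rule mult_left_mono)
        show "1 / 2 \<le> (1 - ?U)\<^sup>2 + ?U\<^sup>2"
          using zero_le_power2[of "2 * ?U - 1"] by (simp add: power2_eq_square algebra_simps)
      qed (use d in simp)
      ultimately show ?thesis using V[of n] unfolding distrib_left by linarith
    qed
    then show ?thesis using d by (intro exI[of _ "d / 2"]) simp
  qed
qed

lemma lim_post_cov_diag_pos:
  assumes x: "x \<in> X" and not_known: "\<not> known x"
  shows "lim (\<lambda>n. post_cov \<kappa> s2 n xs x x) > 0"
proof -
  obtain d where d: "d > 0" "\<And>n. post_cov \<kappa> s2 n xs x x \<ge> d"
    using post_cov_diag_lower_bound[OF assms] by blast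
  obtain L where L: "(\<lambda>n. post_cov \<kappa> s2 n xs x x) \<longlonglongrightarrow> L"
    using decseq_convergent[OF post_cov_diag_decseq[OF x], of 0] post_cov_diag_nonneg[OF x] by metis
  have "d \<le> L" by (rule LIMSEQ_le_const[OF L]) (use d in auto)
  then show ?thesis using L d by (simp add: limI)
qed

text \<open>By coercivity the posterior variance dominates the square of each coefficient of the
  residual, up to a constant.\<close>

lemma resid_tendsto_0:
  assumes x: "x \<in> X" "known x" and t: "t \<in> X"
  shows "(\<lambda>n. resid n x t) \<longlonglongrightarrow> 0"
proof -
  obtain l where l: "l > 0" "\<And>u. form u u \<ge> l * (u t)\<^sup>2"
    using form_coercive[OF t] by blast
  have "(\<lambda>n. (resid n x t)\<^sup>2) \<longlonglongrightarrow> 0"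
  proof (rule real_tendsto_sandwich[where f = "\<lambda>_. 0"])
    show "(\<lambda>n. post_cov \<kappa> s2 n xs x x / l) \<longlonglongrightarrow> 0"
      by (rule tendsto_divide_zero[OF post_cov_diag_tendsto_0[OF x]])
    have "(resid n x t)\<^sup>2 \<le> post_cov \<kappa> s2 n xs x x / l" for n
    proof -
      have "s2 * (\<Sum>i<n. weights n x i * weights n x i) \<ge> 0"
        using s2 by (simp add: sum_nonneg)
      then have "l * (resid n x t)\<^sup>2 \<le> post_cov \<kappa> s2 n xs x x"
        using l(2)[of "resid n x"] x by (simp add: post_cov_eq)
      then show ?thesis using l by (simp add: field_simps)
    qed
    then show "\<forall>\<^sub>F n in sequentially. (resid n x t)\<^sup>2 \<le> post_cov \<kappa> s2 n xs x x / l" by simp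
  qed auto
  then have "(\<lambda>n. sqrt ((resid n x t)\<^sup>2)) \<longlonglongrightarrow> sqrt 0"
    by (rule tendsto_real_sqrt)
  then show ?thesis by (simp add: tendsto_rabs_zero_iff)
qed

text \<open>By the normal equations the weights depend on the design only, so the noise enters through
  its average at each design.\<close>

lemma noise_term_eq:
  assumes "s2 > 0" "x \<in> X"
  shows "(\<Sum>i<n. weights n x i * \<epsilon> i) =
    (\<Sum>t\<in>X. agg n (weights n x) t * (agg n \<epsilon> t / visits xs n t))"
proof -
  define g where "g = (\<lambda>s. (\<Sum>t\<in>X. \<kappa> s t * resid n x t) / s2)"
  have g: "weights n x i = g (xs i)" if "i < n" for i
    using resid_normal[OF that assms(2)] assms(1) by (simp add: g_def)
  have "agg n (weights n x) t = (\<Sum>i | i < n \<and> xs i = t. g t)" for t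
    unfolding agg_def by (rule sum.cong) (auto simp: g)
  then have agg: "agg n (weights n x) t = visits xs n t * g t" for t
    by (simp add: visits_def)
  \<comment> \<open>At an unsampled design the average is read as 0, in agreement with the empty
    noise sum.\<close>
  have no_visits: "agg n \<epsilon> t = 0" if "visits xs n t = 0" for t
  proof -
    have "{i. i < n \<and> xs i = t} = {}" using that by (simp add: visits_def)
    then show ?thesis unfolding agg_def by (simp only: sum.empty)
  qed
  have "(\<Sum>i<n. weights n x i * \<epsilon> i) = (\<Sum>i<n. \<epsilon> i * g (xs i))"
    by (simp add: g mult_ac)
  also have "\<dots> = (\<Sum>t\<in>X. agg n \<epsilon> t * g t)" by (rule sum_eq_agg)
  also have "\<dots> = (\<Sum>t\<in>X. agg n (weights n x) t * (agg n \<epsilon> t / visits xs n t))"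
    by (intro sum.cong refl) (use no_visits in \<open>auto simp: agg\<close>)
  finally show ?thesis .
qed

text \<open>The bias vanishes with the residual. At designs sampled infinitely often the noise
  averages out; at the others its average is eventually constant, but the total weight there tends
  to 0.\<close>

lemma post_mean_tendsto:
  assumes x: "x \<in> X" "known x" and no_noise: "s2 = 0 \<Longrightarrow> \<forall>i. \<epsilon> i = 0"
    and lln: "\<And>t. s2 > 0 \<Longrightarrow> t \<in> X \<Longrightarrow> infinite {i. xs i = t} \<Longrightarrow>
      (\<lambda>n. agg n \<epsilon> t / visits xs n t) \<longlonglongrightarrow> 0"
  shows "(\<lambda>n. post_mean m \<kappa> s2 n xs (\<lambda>i. f (xs i) + \<epsilon> i) x) \<longlonglongrightarrow> f x"
proof -
  have "(\<lambda>n. \<Sum>t\<in>X. resid n x t * (f t - m t)) \<longlonglongrightarrow> (\<Sum>t\<in>X. 0 * (f t - m t))"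
    by (intro tendsto_intros resid_tendsto_0 x)
  moreover have "(\<lambda>n. \<Sum>i<n. weights n x i * \<epsilon> i) \<longlonglongrightarrow> 0"
  proof (cases "s2 = 0")
    case True
    then show ?thesis using no_noise by simp
  next
    case False
    then have s2p: "s2 > 0" using s2 by simp
    have "(\<lambda>n. agg n (weights n x) t * (agg n \<epsilon> t / visits xs n t)) \<longlonglongrightarrow> 0" if t: "t \<in> X" for t
    proof -
      have "(\<lambda>n. pdelta x t - resid n x t) \<longlonglongrightarrow> pdelta x t - 0"
        by (intro tendsto_intros resid_tendsto_0 x t)
      then have U: "(\<lambda>n. agg n (weights n x) t) \<longlonglongrightarrow> pdelta x t"
        by (simp add: resid_def)
      show ?thesis
      proof (cases "infinite {i. xs i = t}")
        case True
        then show ?thesis using tendsto_mult[OF U lln[OF s2p t True]] by simp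
      next
        case fin: False
        then obtain b where b: "\<forall>i\<in>{i. xs i = t}. i < b" using finite_nat_set_iff_bounded by auto
        have "agg n \<epsilon> t / visits xs n t = agg b \<epsilon> t / visits xs b t" if "n \<ge> b" for n
        proof -
          have "{i. i < n \<and> xs i = t} = {i. i < b \<and> xs i = t}" using b that by force
          then show ?thesis unfolding agg_def visits_def by simp
        qed
        then have avg: "(\<lambda>n. agg n \<epsilon> t / visits xs n t) \<longlonglongrightarrow> agg b \<epsilon> t / visits xs b t"
          by (rule tendsto_eventually[OF eventually_mono[OF eventually_ge_at_top[of b]]])
        have "pdelta x t = 0"
          using x fin False by (auto simp: known_def pdelta_def)
        then show ?thesis using tendsto_mult[OF U avg] by simp
      qed
    qed
    then have "(\<lambda>n. \<Sum>t\<in>X. agg n (weights n x) t * (agg n \<epsilon> t / visits xs n t)) \<longlonglongrightarrow> (\<Sum>t\<in>X. 0)"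
      by (rule tendsto_sum)
    then show ?thesis using noise_term_eq[OF s2p x(1)] by simp
  qed
  ultimately have "(\<lambda>n. (\<Sum>i<n. weights n x i * \<epsilon> i) - (\<Sum>t\<in>X. resid n x t * (f t - m t))) \<longlonglongrightarrow> 0 - 0"
    by (intro tendsto_diff) auto
  then have "(\<lambda>n. post_mean m \<kappa> s2 n xs (\<lambda>i. f (xs i) + \<epsilon> i) x - f x) \<longlonglongrightarrow> 0"
    using no_noise by (subst post_mean_error[OF x(1)]) auto
  then show ?thesis by (rule LIM_zero_cancel)
qed

end

section \<open>A law of large numbers for predictable sampling\<close>

text \<open>Completing the square: the exponential factor turns the centred normal density into the
  one with mean \<open>\<theta> * \<sigma>\<^sup>2\<close>.\<close>

lemma nn_integral_exp_normal:
  assumes "\<sigma> > 0"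
  shows "(\<integral>\<^sup>+x. ennreal (exp (\<theta> * x - \<theta>\<^sup>2 * \<sigma>\<^sup>2 / 2)) \<partial>density lborel (normal_density 0 \<sigma>)) = 1"
proof -
  have eq: "normal_density 0 \<sigma> x * exp (\<theta> * x - \<theta>\<^sup>2 * \<sigma>\<^sup>2 / 2) = normal_density (\<theta> * \<sigma>\<^sup>2) \<sigma> x" for x
  proof -
    have "- (x\<^sup>2) / (2 * \<sigma>\<^sup>2) + (\<theta> * x - \<theta>\<^sup>2 * \<sigma>\<^sup>2 / 2) = - ((x - \<theta> * \<sigma>\<^sup>2)\<^sup>2) / (2 * \<sigma>\<^sup>2)"
      using assms by (simp add: field_simps power2_eq_square)
    then show ?thesis by (simp add: normal_density_def exp_add[symmetric])
  qed
  interpret N: prob_space "density lborel (normal_density (\<theta> * \<sigma>\<^sup>2) \<sigma>)"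
    by (rule prob_space_normal_density[OF assms])
  have "(\<integral>\<^sup>+x. ennreal (exp (\<theta> * x - \<theta>\<^sup>2 * \<sigma>\<^sup>2 / 2)) \<partial>density lborel (normal_density 0 \<sigma>))
      = (\<integral>\<^sup>+x. ennreal (normal_density (\<theta> * \<sigma>\<^sup>2) \<sigma> x) \<partial>lborel)"
    by (subst nn_integral_density) (simp_all add: ennreal_mult[symmetric] eq)
  also have "\<dots> = emeasure (density lborel (normal_density (\<theta> * \<sigma>\<^sup>2) \<sigma>)) UNIV"
    by (subst emeasure_density) simp_all
  also have "\<dots> = 1" using N.emeasure_space_1 by simp
  finally show ?thesis .
qed

text \<open>\<open>A n\<close> stands for the event that sample n is taken at one given design. It
  belongs to \<open>F n\<close>, hence is decided before noise n is drawn, but may depend on all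
  earlier noise.\<close>

locale sampled_noise = prob_space M + filtration "space M" F
  for M :: "'w measure" and F :: "nat \<Rightarrow> 'w measure" +
  fixes \<epsilon> :: "nat \<Rightarrow> 'w \<Rightarrow> real" and s2 :: real and A :: "nat \<Rightarrow> 'w set"
  assumes s2_pos: "s2 > 0"
    and sets_F: "\<And>n. sets (F n) \<subseteq> sets M"
    and noise_adapted: "\<And>n. \<epsilon> n \<in> borel_measurable (F (Suc n))"
    and noise_distr: "\<And>n. distr M borel (\<epsilon> n) = gauss 0 s2"
    and noise_indep: "\<And>n. indep_set (sets (F n)) {\<epsilon> n -` B \<inter> space M | B. B \<in> sets borel}"
    and A: "\<And>n. A n \<in> sets (F n)"
begin

lemma measurable_F_le: "m \<le> n \<Longrightarrow> f \<in> measurable (F m) N \<Longrightarrow> f \<in> measurable (F n) N"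
  using measurable_mono[of N N "F m" "F n"] sets_F_mono[of m n] by (simp add: space_F subset_eq)

lemma measurable_F_M: "f \<in> measurable (F n) N \<Longrightarrow> f \<in> measurable M N"
  using measurable_mono[of N N "F n" M] sets_F[of n] by (simp add: space_F subset_eq)

text \<open>Independence from \<open>F n\<close> gives (\<open>U\<close>,
  \<open>\<epsilon> n\<close>) a product law, so the integral factors by Tonelli.\<close>

lemma nn_integral_mult_noise:
  fixes U :: "'w \<Rightarrow> real"
  assumes U: "U \<in> borel_measurable (F n)" and g[measurable]: "g \<in> borel_measurable borel"
  shows "(\<integral>\<^sup>+\<omega>. ennreal (U \<omega>) * g (\<epsilon> n \<omega>) \<partial>M) = (\<integral>\<^sup>+\<omega>. ennreal (U \<omega>) \<partial>M) * (\<integral>\<^sup>+e. g e \<partial>gauss 0 s2)"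
proof -
  have [measurable]: "U \<in> borel_measurable M" "\<epsilon> n \<in> borel_measurable M"
    using U noise_adapted measurable_F_M by blast+
  have "indep_set (sigma_sets (space M) (sets (F n)))
      (sigma_sets (space M) {\<epsilon> n -` B \<inter> space M | B. B \<in> sets borel})"
  proof (rule indep_set_sigma_sets[OF noise_indep])
    show "Int_stable (sets (F n))" by (rule sets.Int_stable)
    show "Int_stable {\<epsilon> n -` B \<inter> space M | B. B \<in> sets borel}"
    proof (rule Int_stableI)
      fix a b assume "a \<in> {\<epsilon> n -` B \<inter> space M | B. B \<in> sets borel}" "b \<in> {\<epsilon> n -` B \<inter> space M | B. B \<in> sets borel}"
      then obtain B C where "a = \<epsilon> n -` B \<inter> space M" "b = \<epsilon> n -` C \<inter> space M" "B \<in> sets borel" "C \<in> sets borel"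
        by blast
      then show "a \<inter> b \<in> {\<epsilon> n -` B \<inter> space M | B. B \<in> sets borel}"
        by (intro CollectI exI[of _ "B \<inter> C"]) auto
    qed
  qed
  moreover have "sigma_sets (space M) {U -` B \<inter> space M | B. B \<in> sets borel} \<subseteq> sigma_sets (space M) (sets (F n))"
    using measurable_sets[OF U] by (intro sigma_sets_subseteq) (auto simp: space_F)
  ultimately have "indep_set (sigma_sets (space M) {U -` B \<inter> space M | B. B \<in> sets borel})
      (sigma_sets (space M) {\<epsilon> n -` B \<inter> space M | B. B \<in> sets borel})"
    unfolding indep_set_def by (elim indep_sets_mono_sets) (auto split: bool.split)
  then have "indep_var borel U borel (\<epsilon> n)" by (simp add: indep_var_eq)
  then have distr: "distr M borel U \<Otimes>\<^sub>M gauss 0 s2 = distr M (borel \<Otimes>\<^sub>M borel) (\<lambda>\<omega>. (U \<omega>, \<epsilon> n \<omega>))"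
    by (simp add: indep_var_distribution_eq noise_distr)
  interpret E: prob_space "gauss 0 s2"
    unfolding noise_distr[of n, symmetric] by (rule prob_space_distr) simp
  have sets_gauss[measurable_cong]: "sets (gauss 0 s2) = sets borel"
    unfolding noise_distr[of n, symmetric] by simp
  have "(\<integral>\<^sup>+\<omega>. ennreal (U \<omega>) * g (\<epsilon> n \<omega>) \<partial>M) =
      (\<integral>\<^sup>+p. ennreal (fst p) * g (snd p) \<partial>distr M (borel \<Otimes>\<^sub>M borel) (\<lambda>\<omega>. (U \<omega>, \<epsilon> n \<omega>)))"
    by (subst nn_integral_distr) simp_all
  also have "\<dots> = (\<integral>\<^sup>+u. \<integral>\<^sup>+e. ennreal u * g e \<partial>gauss 0 s2 \<partial>distr M borel U)"
    unfolding distr[symmetric] by (subst E.nn_integral_fst[symmetric]) simp_all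
  also have "\<dots> = (\<integral>\<^sup>+u. ennreal u * (\<integral>\<^sup>+e. g e \<partial>gauss 0 s2) \<partial>distr M borel U)"
    by (intro nn_integral_cong nn_integral_cmult) simp
  also have "\<dots> = (\<integral>\<^sup>+\<omega>. ennreal (U \<omega>) \<partial>M) * (\<integral>\<^sup>+e. g e \<partial>gauss 0 s2)"
    by (simp add: nn_integral_multc nn_integral_distr)
  finally show ?thesis .
qed

lemma nn_integral_exp_noise:
  "(\<integral>\<^sup>+e. ennreal (exp (\<theta> * e - \<theta>\<^sup>2 * s2 / 2)) \<partial>gauss 0 s2) = 1"
  using nn_integral_exp_normal[of "sqrt s2" \<theta>] s2_pos by (simp add: gauss_def)

text \<open>On \<open>B n\<close> the next factor is independent of the past and has mean 1; off
  \<open>B n\<close> it equals 1. Arbitrary predictable events \<open>B i\<close> are allowed so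
  that the martingale can be stopped later.\<close>

lemma nn_integral_exp_martingale:
  assumes B: "\<And>i. B i \<in> sets (F i)"
  shows "(\<integral>\<^sup>+\<omega>. ennreal (exp (\<Sum>i<n. indicator (B i) \<omega> * (\<theta> * \<epsilon> i \<omega> - \<theta>\<^sup>2 * s2 / 2))) \<partial>M) = 1"
proof (induction n)
  case 0
  then show ?case by (simp add: emeasure_space_1)
next
  case (Suc n)
  define D where "D = (\<lambda>\<omega>. exp (\<Sum>i<n. indicator (B i) \<omega> * (\<theta> * \<epsilon> i \<omega> - \<theta>\<^sup>2 * s2 / 2)))"
  define h where "h = (\<lambda>e. exp (\<theta> * e - \<theta>\<^sup>2 * s2 / 2))"
  have [measurable]: "B n \<in> sets (F n)" by (rule B)
  have D: "D \<in> borel_measurable (F n)"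
  proof -
    have [measurable]: "\<epsilon> i \<in> borel_measurable (F n)" "B i \<in> sets (F n)" if "i < n" for i
      using measurable_F_le[OF _ noise_adapted, of i n] B[of i] sets_F_mono[of i n] that by auto
    show ?thesis unfolding D_def
      by (intro borel_measurable_exp[THEN measurable_compose[rotated]] borel_measurable_sum) measurable
  qed
  have [measurable]: "D \<in> borel_measurable M" "B n \<in> sets M" "\<epsilon> n \<in> borel_measurable M"
    using D B sets_F noise_adapted measurable_F_M by blast+
  have "(\<integral>\<^sup>+\<omega>. ennreal (exp (\<Sum>i<Suc n. indicator (B i) \<omega> * (\<theta> * \<epsilon> i \<omega> - \<theta>\<^sup>2 * s2 / 2))) \<partial>M)
     = (\<integral>\<^sup>+\<omega>. ennreal (D \<omega> * indicator (B n) \<omega>) * ennreal (h (\<epsilon> n \<omega>)) + ennreal (D \<omega> * (1 - indicator (B n) \<omega>)) \<partial>M)"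
    by (intro nn_integral_cong) (auto simp: D_def h_def exp_add ennreal_mult[symmetric] split: split_indicator)
  also have "\<dots> = (\<integral>\<^sup>+\<omega>. ennreal (D \<omega> * indicator (B n) \<omega>) * ennreal (h (\<epsilon> n \<omega>)) \<partial>M)
      + (\<integral>\<^sup>+\<omega>. ennreal (D \<omega> * (1 - indicator (B n) \<omega>)) \<partial>M)"
    by (subst nn_integral_add) (simp_all add: h_def)
  also have "(\<integral>\<^sup>+\<omega>. ennreal (D \<omega> * indicator (B n) \<omega>) * ennreal (h (\<epsilon> n \<omega>)) \<partial>M)
      = (\<integral>\<^sup>+\<omega>. ennreal (D \<omega> * indicator (B n) \<omega>) \<partial>M) * 1"
    by (subst nn_integral_mult_noise) (use D in \<open>simp_all add: h_def nn_integral_exp_noise\<close>)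
  also have "\<dots> + (\<integral>\<^sup>+\<omega>. ennreal (D \<omega> * (1 - indicator (B n) \<omega>)) \<partial>M) = (\<integral>\<^sup>+\<omega>. ennreal (D \<omega>) \<partial>M)"
  proof -
    have "\<dots> + (\<integral>\<^sup>+\<omega>. ennreal (D \<omega> * (1 - indicator (B n) \<omega>)) \<partial>M)
      = (\<integral>\<^sup>+\<omega>. ennreal (D \<omega> * indicator (B n) \<omega>) + ennreal (D \<omega> * (1 - indicator (B n) \<omega>)) \<partial>M)"
      by (subst nn_integral_add) simp_all
    also have "\<dots> = (\<integral>\<^sup>+\<omega>. ennreal (D \<omega>) \<partial>M)"
      by (intro nn_integral_cong) (auto split: split_indicator)
    finally show ?thesis .
  qed
  finally show ?case using Suc by (simp add: D_def)
qed

section \<open>Deviations of the sampled noise and their average\<close>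

definition cnt :: "nat \<Rightarrow> 'w \<Rightarrow> real" where
  "cnt n \<omega> = (\<Sum>i<n. indicator (A i) \<omega>)"

definition total :: "nat \<Rightarrow> 'w \<Rightarrow> real" where
  "total n \<omega> = (\<Sum>i<n. indicator (A i) \<omega> * \<epsilon> i \<omega>)"

lemma cnt_measurable: "cnt n \<in> borel_measurable (F n)"
proof -
  have "A i \<in> sets (F n)" if "i < n" for i
    using A[of i] sets_F_mono[of i n] that by auto
  then show ?thesis unfolding cnt_def[abs_def] by (intro borel_measurable_sum borel_measurable_indicator) auto
qed

lemma noise_measurable: "\<epsilon> n \<in> borel_measurable M"
  using noise_adapted measurable_F_M by blast

lemma A_measurable: "A n \<in> sets M"
  using A sets_F by blast

lemma total_measurable: "total n \<in> borel_measurable M"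
  unfolding total_def[abs_def] using noise_measurable A_measurable by measurable

text \<open>The exponential martingale stopped at the k-th sample bounds the deviation of the sum of
  the first k sampled noise values, uniformly in the time at which they have been collected.\<close>

lemma deviation_bound:
  "prob (\<Union>n. {\<omega>\<in>space M. cnt n \<omega> = real k \<and> \<theta> * total n \<omega> \<ge> \<theta>\<^sup>2 * s2 * real k})
    \<le> exp (- (\<theta>\<^sup>2 * s2 / 2 * real k))"
proof -
  define B where "B = (\<lambda>i. A i \<inter> {\<omega>\<in>space (F i). cnt i \<omega> < real k})"
  define L where "L = (\<lambda>n \<omega>. \<Sum>i<n. indicator (B i) \<omega> * (\<theta> * \<epsilon> i \<omega> - \<theta>\<^sup>2 * s2 / 2))"
  \<comment> \<open>With \<open>real k \<le> cnt n \<omega>\<close> in place of equality, these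
    events increase in n: after the k-th sample \<open>L\<close> is frozen. Their union over all
    times then has the limit of their probabilities.\<close>
  define bad where "bad = (\<lambda>n. {\<omega>\<in>space M. real k \<le> cnt n \<omega> \<and> \<theta>\<^sup>2 * s2 / 2 * real k \<le> L n \<omega>})"
  have B: "B i \<in> sets (F i)" for i
    unfolding B_def using A cnt_measurable by measurable
  have [measurable]: "cnt i \<in> borel_measurable M" "\<epsilon> i \<in> borel_measurable M" "B i \<in> sets M" for i
    using cnt_measurable measurable_F_M noise_measurable B sets_F by blast+
  have [measurable]: "L n \<in> borel_measurable M" for n
    unfolding L_def by measurable
  have bad_sets[measurable]: "bad n \<in> sets M" for n
    unfolding bad_def by measurable
  \<comment> \<open>Up to the k-th sample nothing has been cut off by the stopping.\<close>
  have L_eq: "L n \<omega> = \<theta> * total n \<omega> - \<theta>\<^sup>2 * s2 / 2 * cnt n \<omega>"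
    if "cnt n \<omega> \<le> real k" "\<omega> \<in> space M" for n \<omega>
    using that(1)
  proof (induction n)
    case (Suc n)
    then have "cnt n \<omega> \<le> real k" by (simp add: cnt_def split: split_indicator_asm)
    with Suc show ?case
      using that(2) by (auto simp: L_def total_def cnt_def B_def space_F algebra_simps split: split_indicator)
  qed (simp add: L_def total_def cnt_def)
  have "bad n \<subseteq> bad (Suc n)" for n
  proof
    fix \<omega> assume *: "\<omega> \<in> bad n"
    then have "\<omega> \<notin> B n" by (simp add: B_def bad_def)
    then have "L (Suc n) \<omega> = L n \<omega>" unfolding L_def sum.lessThan_Suc by simp
    moreover have "cnt n \<omega> \<le> cnt (Suc n) \<omega>" by (simp add: cnt_def)
    ultimately show "\<omega> \<in> bad (Suc n)" using * by (auto simp: bad_def)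
  qed
  then have inc: "incseq bad" by (rule incseq_SucI)
  have "emeasure M (bad n) \<le> ennreal (exp (- (\<theta>\<^sup>2 * s2 / 2 * real k)))" for n
  proof -
    have "emeasure M (bad n) = (\<integral>\<^sup>+\<omega>. indicator (bad n) \<omega> \<partial>M)" by simp
    also have "\<dots> \<le> (\<integral>\<^sup>+\<omega>. ennreal (exp (- (\<theta>\<^sup>2 * s2 / 2 * real k))) * ennreal (exp (L n \<omega>)) \<partial>M)"
    proof (intro nn_integral_mono)
      fix \<omega>
      show "indicator (bad n) \<omega> \<le> ennreal (exp (- (\<theta>\<^sup>2 * s2 / 2 * real k))) * ennreal (exp (L n \<omega>))"
      proof (cases "\<omega> \<in> bad n")
        case True
        then have "1 \<le> exp (- (\<theta>\<^sup>2 * s2 / 2 * real k)) * exp (L n \<omega>)"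
          by (simp add: exp_add[symmetric] bad_def)
        then show ?thesis using True by (simp add: ennreal_mult[symmetric])
      qed simp
    qed
    also have "\<dots> = ennreal (exp (- (\<theta>\<^sup>2 * s2 / 2 * real k))) * (\<integral>\<^sup>+\<omega>. ennreal (exp (L n \<omega>)) \<partial>M)"
      by (rule nn_integral_cmult) simp
    also have "(\<integral>\<^sup>+\<omega>. ennreal (exp (L n \<omega>)) \<partial>M) = 1"
      unfolding L_def by (rule nn_integral_exp_martingale[OF B])
    finally show ?thesis by simp
  qed
  then have bad: "prob (bad n) \<le> exp (- (\<theta>\<^sup>2 * s2 / 2 * real k))" for n
    by (simp add: emeasure_eq_measure)
  have "(\<lambda>n. prob (bad n)) \<longlonglongrightarrow> prob (\<Union>n. bad n)"
    using inc by (intro finite_Lim_measure_incseq) auto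
  then have "prob (\<Union>n. bad n) \<le> exp (- (\<theta>\<^sup>2 * s2 / 2 * real k))"
    by (rule LIMSEQ_le_const2) (use bad in auto)
  moreover have "prob (\<Union>n. {\<omega>\<in>space M. cnt n \<omega> = real k \<and> \<theta> * total n \<omega> \<ge> \<theta>\<^sup>2 * s2 * real k}) \<le> prob (\<Union>n. bad n)"
    by (intro finite_measure_mono UN_mono) (auto simp: bad_def L_eq mult_ac)
  ultimately show ?thesis by linarith
qed

text \<open>Borel-Cantelli in the number k of collected samples instead of the time; the bounds form
  a convergent geometric series.\<close>

lemma deviation_AE:
  assumes "\<theta> \<noteq> 0"
  shows "AE \<omega> in M. \<forall>\<^sub>F k in sequentially. \<forall>n. cnt n \<omega> = real k \<longrightarrow> \<theta> * total n \<omega> < \<theta>\<^sup>2 * s2 * real k"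
proof -
  define E where "E = (\<lambda>k. \<Union>n. {\<omega>\<in>space M. cnt n \<omega> = real k \<and> \<theta> * total n \<omega> \<ge> \<theta>\<^sup>2 * s2 * real k})"
  have [measurable]: "cnt i \<in> borel_measurable M" "total i \<in> borel_measurable M" for i
    using cnt_measurable measurable_F_M total_measurable by blast+
  define q where "q = exp (- (\<theta>\<^sup>2 * s2 / 2))"
  have q: "0 < q" "q < 1" using assms s2_pos by (auto simp: q_def)
  have "prob (E k) \<le> q ^ k" for k
    using deviation_bound[of k \<theta>] unfolding E_def q_def exp_of_nat_mult[symmetric] by (simp add: mult_ac)
  then have "summable (\<lambda>k. prob (E k))"
    using q by (intro summable_comparison_test[OF _ summable_geometric[of q]]) auto
  then have "AE \<omega> in M. \<forall>\<^sub>F k in sequentially. \<omega> \<in> space M - E k"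
    by (intro borel_cantelli_AE1) (auto simp: E_def emeasure_eq_measure)
  then show ?thesis
    by (rule AE_mp) (auto intro!: AE_I2 elim!: eventually_mono simp: E_def not_le)
qed

lemma cnt_eq: "cnt n \<omega> = real (card {i. i < n \<and> \<omega> \<in> A i})"
proof -
  have "cnt n \<omega> = (\<Sum>i | i < n \<and> \<omega> \<in> A i. 1)"
    unfolding cnt_def by (rule sum.mono_neutral_cong_right) auto
  then show ?thesis by simp
qed

lemma total_eq: "total n \<omega> = (\<Sum>i | i < n \<and> \<omega> \<in> A i. \<epsilon> i \<omega>)"
  unfolding total_def by (rule sum.mono_neutral_cong_right) auto

text \<open>Taking \<open>\<theta>\<close> = 1 / (j + 1) with both signs bounds the average noise in
  absolute value by 1 / (j + 1) times \<open>s2\<close>, eventually; countably many j share one null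
  set.\<close>

lemma lln:
  "AE \<omega> in M. filterlim (\<lambda>n. card {i. i < n \<and> \<omega> \<in> A i}) at_top sequentially \<longrightarrow>
    (\<lambda>n. (\<Sum>i | i < n \<and> \<omega> \<in> A i. \<epsilon> i \<omega>) / card {i. i < n \<and> \<omega> \<in> A i}) \<longlonglongrightarrow> 0"
proof -
  have "AE \<omega> in M. \<forall>j. \<forall>\<^sub>F k in sequentially. \<forall>n. cnt n \<omega> = real k \<longrightarrow>
      inverse (real (Suc j)) * total n \<omega> < (inverse (real (Suc j)))\<^sup>2 * s2 * real k"
    unfolding AE_all_countable by (intro allI deviation_AE) simp
  moreover have "AE \<omega> in M. \<forall>j. \<forall>\<^sub>F k in sequentially. \<forall>n. cnt n \<omega> = real k \<longrightarrow>
      - inverse (real (Suc j)) * total n \<omega> < (- inverse (real (Suc j)))\<^sup>2 * s2 * real k"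
    unfolding AE_all_countable by (intro allI deviation_AE) simp
  ultimately show ?thesis
  proof eventually_elim
    case (elim \<omega>)
    show ?case
    proof (intro impI LIMSEQ_I)
      let ?N = "\<lambda>n. card {i. i < n \<and> \<omega> \<in> A i}"
      fix r :: real assume N: "filterlim ?N at_top sequentially" and "r > 0"
      then obtain j where j: "inverse (real (Suc j)) < r / s2"
        using reals_Archimedean[of "r / s2"] s2_pos by auto
      define \<theta> where "\<theta> = inverse (real (Suc j))"
      have \<theta>: "\<theta> > 0" "\<theta> * s2 < r" using j s2_pos by (auto simp: \<theta>_def field_simps)
      have "\<forall>\<^sub>F k in sequentially. \<forall>n. cnt n \<omega> = real k \<longrightarrow> k > 0 \<and>
          \<theta> * total n \<omega> < \<theta>\<^sup>2 * s2 * real k \<and> - \<theta> * total n \<omega> < (- \<theta>)\<^sup>2 * s2 * real k"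
        using elim(1)[rule_format, of j] elim(2)[rule_format, of j] eventually_gt_at_top[of 0]
        by eventually_elim (auto simp: \<theta>_def)
      from eventually_compose_filterlim[OF this N]
      have "\<forall>\<^sub>F n in sequentially. norm ((\<Sum>i | i < n \<and> \<omega> \<in> A i. \<epsilon> i \<omega>) / ?N n - 0) < r"
      proof eventually_elim
        case (elim n)
        then have N: "real (?N n) > 0" and "\<theta> * total n \<omega> < \<theta> * (\<theta> * s2 * real (?N n))"
          "\<theta> * (- total n \<omega>) < \<theta> * (\<theta> * s2 * real (?N n))"
          using cnt_eq[of n \<omega>] by (auto simp: power2_eq_square mult_ac)
        then have "\<bar>total n \<omega>\<bar> < \<theta> * s2 * real (?N n)"
          unfolding mult_less_cancel_left_pos[OF \<theta>(1)] by linarith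
        then have "\<bar>total n \<omega>\<bar> / real (?N n) < \<theta> * s2"
          using N by (simp add: pos_divide_less_eq)
        then show ?case using \<theta> by (simp add: total_eq)
      qed
      then show "\<exists>no. \<forall>n\<ge>no. norm ((\<Sum>i | i < n \<and> \<omega> \<in> A i. \<epsilon> i \<omega>) / ?N n - 0) < r"
        by (simp add: eventually_sequentially)
    qed
  qed
qed

end

section \<open>Vanishing constrained knowledge gradient\<close>

lemma prob_space_gauss: "prob_space (gauss m v)"
proof (cases "v = 0")
  case True
  then show ?thesis by (simp add: gauss_def prob_space_return)
next
  case False
  \<comment> \<open>For negative v the root is the negative of \<open>sqrt \<bar>v\<bar>\<close>,
    and the density depends on this parameter only through its square.\<close>
  have "normal_density m (sqrt v) = normal_density m (sqrt \<bar>v\<bar>)"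
    by (cases "v \<ge> 0") (simp_all add: fun_eq_iff normal_density_def real_sqrt_minus abs_if)
  then show ?thesis using False prob_space_normal_density[of "sqrt \<bar>v\<bar>" m] by (simp add: gauss_def)
qed

lemma measurable_gauss_atMost: "(\<lambda>m. measure (gauss m v) {..0}) \<in> borel_measurable borel"
proof (cases "v = 0")
  case True
  have "(\<lambda>m. measure (gauss m v) {..0}) = (\<lambda>m. indicator {..0} m)"
    by (simp add: True gauss_def measure_return)
  then show ?thesis by simp
next
  case False
  have "(\<lambda>m. measure (gauss m v) {..0}) =
    (\<lambda>m. enn2real (\<integral>\<^sup>+x. ennreal (normal_density m (sqrt v) x) * indicator {..0} x \<partial>lborel))"
    using False by (simp add: gauss_def measure_def emeasure_density)
  moreover have "(\<lambda>m. \<integral>\<^sup>+x. ennreal (normal_density m (sqrt v) x) * indicator {..0} x \<partial>lborel) \<in> borel_measurable borel"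
    unfolding normal_density_def by (rule lborel.borel_measurable_nn_integral) measurable
  ultimately show ?thesis by simp
qed

lemma prob_feas_bounds: "0 \<le> prob_feas K m v x" "prob_feas K m v x \<le> 1"
  by (auto simp: prob_feas_def intro!: prod_nonneg prod_le_1 prob_space.prob_le_1 prob_space_gauss)

lemma measure_gauss_point: "measure (gauss m 0) {..0} = indicator {..0} m"
  by (simp add: gauss_def measure_return)

lemma slopes_le:
  fixes a b c d :: real
  assumes "\<And>j::nat. \<exists>z\<ge>real j. a + b * z \<le> c + d * z"
  shows "b \<le> d"
proof (rule ccontr)
  assume "\<not> b \<le> d"
  then have bd: "b - d > 0" by simp
  obtain j :: nat where "real j > (c - a) / (b - d)" using reals_Archimedean2 by blast
  then have j: "(b - d) * real j > c - a" using bd by (simp add: field_simps)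
  obtain z where z: "z \<ge> real j" "a + b * z \<le> c + d * z" using assms by blast
  have "(b - d) * real j \<le> (b - d) * z" using bd z by (intro mult_left_mono) auto
  then show False using j z by (simp add: algebra_simps)
qed

abbreviation std_normal :: "real measure" where
  "std_normal \<equiv> density lborel std_normal_density"

lemma emeasure_std_normal_pos:
  assumes "a < b" "{a<..<b} \<subseteq> S" "S \<in> sets borel"
  shows "emeasure std_normal S > 0"
proof -
  have "\<not> (AE x in lborel. x \<in> S \<longrightarrow> std_normal_density x = 0)"
  proof
    assume "AE x in lborel. x \<in> S \<longrightarrow> std_normal_density x = 0"
    then have "AE x in lborel. x \<notin> {a<..<b}"
    proof eventually_elim
      case (elim x)
      then show ?case using assms(2) normal_density_pos[of 1 0 x] by force
    qed
    then have "emeasure lborel {a<..<b} = 0"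
      by (subst (asm) AE_iff_measurable[where N = "{a<..<b}"]) auto
    then show False using assms(1) by simp
  qed
  then have "emeasure std_normal S \<noteq> 0"
    using assms(3) by (subst emeasure_density) (auto simp: nn_integral_0_iff_AE split: split_indicator elim!: eventually_mono)
  then show ?thesis by (simp add: zero_less_iff_neq_zero)
qed

text \<open>Half-lines have positive mass, so innovations avoiding a null set can be picked
  arbitrarily far out on both sides.\<close>

lemma AE_std_normal_unbounded:
  assumes "AE z in std_normal. P z"
  shows "\<exists>z\<ge>c. P z" and "\<exists>z\<le>c. P z"
proof -
  have *: "\<exists>z\<in>S. P z" if S: "a < b" "{a<..<b} \<subseteq> S" "S \<in> sets borel" for S a b
  proof (rule ccontr)
    assume "\<not> ?thesis"
    then have "AE z in std_normal. z \<notin> S" using assms by (auto elim: eventually_mono)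
    then have "emeasure std_normal S = 0"
      using S by (subst (asm) AE_iff_measurable[where N = S]) auto
    then show False using emeasure_std_normal_pos[OF S] by simp
  qed
  show "\<exists>z\<ge>c. P z" using *[of c "c + 1" "{c..}"] by (simp add: subset_eq Bex_def)
  show "\<exists>z\<le>c. P z" using *[of "c - 1" c "{..c}"] by (simp add: subset_eq Bex_def)
qed

section \<open>The updated utility as a function of the innovations\<close>

abbreviation innovations :: "nat \<Rightarrow> (nat \<Rightarrow> real) measure" where
  "innovations K \<equiv> \<Pi>\<^sub>M k\<in>{1..K}. std_normal"

lemma prob_space_std_normal: "prob_space std_normal"
  by (rule prob_space_normal_density) simp

lemma prob_space_innovations: "prob_space (innovations K)"
  by (rule prob_space_PiM) (rule prob_space_std_normal)

text \<open>The feasibility factor of \<open>next_value\<close>, split off because it does not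
  involve the objective innovation; this makes the utility affine in \<open>zy\<close>.\<close>

definition next_feas ::
    "nat \<Rightarrow> (nat \<Rightarrow> 'a \<Rightarrow> real) \<Rightarrow> (nat \<Rightarrow> 'a \<Rightarrow> 'a \<Rightarrow> real) \<Rightarrow> 'a \<Rightarrow> (nat \<Rightarrow> real) \<Rightarrow> 'a \<Rightarrow> real" where
  "next_feas K \<mu>c \<kappa>c x zc =
     prob_feas K (\<lambda>k u. \<mu>c k u + sigma_tilde (\<kappa>c k) 0 u x * zc k)
                 (\<lambda>k u. \<kappa>c k u u - (sigma_tilde (\<kappa>c k) 0 u x)\<^sup>2)"

lemma next_value_eq:
  "next_value K s2 \<mu>y \<kappa>y \<mu>c \<kappa>c x zy zc x' =
    (\<mu>y x' + sigma_tilde \<kappa>y s2 x' x * zy) * next_feas K \<mu>c \<kappa>c x zc x'"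
  by (simp add: next_value_def next_feas_def)

lemma next_feas_bounds: "0 \<le> next_feas K \<mu>c \<kappa>c x zc x'" "next_feas K \<mu>c \<kappa>c x zc x' \<le> 1"
  by (simp_all add: next_feas_def prob_feas_bounds)

lemma measurable_next_feas: "(\<lambda>zc. next_feas K \<mu>c \<kappa>c x zc x') \<in> borel_measurable (innovations K)"
  unfolding next_feas_def prob_feas_def
proof (rule borel_measurable_prod)
  fix k assume [measurable]: "k \<in> {1..K}"
  have "(\<lambda>zc. \<mu>c k x' + sigma_tilde (\<kappa>c k) 0 x' x * zc k) \<in> borel_measurable (innovations K)"
    by measurable
  then show "(\<lambda>zc. measure (gauss (\<mu>c k x' + sigma_tilde (\<kappa>c k) 0 x' x * zc k)
      (\<kappa>c k x' x' - (sigma_tilde (\<kappa>c k) 0 x' x)\<^sup>2)) {..0}) \<in> borel_measurable (innovations K)"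
    by (rule measurable_compose[OF _ measurable_gauss_atMost])
qed

text \<open>The utility is dominated by an affine function of \<open>zy\<close>, as the feasibility
  factor lies in [0, 1]. Integrability matters because a Bochner integral that does not exist is 0,
  and \<open>cKG\<close> being 0 would then carry no information.\<close>

lemma integrable_next_value:
  "integrable (std_normal \<Otimes>\<^sub>M innovations K)
    (\<lambda>z. next_value K s2 \<mu>y \<kappa>y \<mu>c \<kappa>c x (fst z) (snd z) x')"
proof -
  interpret N: prob_space std_normal by (rule prob_space_std_normal)
  interpret I: prob_space "innovations K" by (rule prob_space_innovations)
  interpret P: pair_prob_space std_normal "innovations K" ..
  have "integrable std_normal (\<lambda>z. z)"
    using integrable_normal_moment[of 1 0 1] by (subst integrable_density) simp_all
  then have "integrable (distr (std_normal \<Otimes>\<^sub>M innovations K) std_normal fst) (\<lambda>z. z)"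
    by (simp only: I.distr_pair_fst)
  then have fst: "integrable (std_normal \<Otimes>\<^sub>M innovations K) fst"
    by (rule integrable_distr[OF measurable_fst])
  have [measurable]: "(\<lambda>z. next_feas K \<mu>c \<kappa>c x (snd z) x') \<in> borel_measurable (std_normal \<Otimes>\<^sub>M innovations K)"
    by (rule measurable_compose[OF measurable_snd measurable_next_feas])
  have "integrable (std_normal \<Otimes>\<^sub>M innovations K) (\<lambda>z. \<mu>y x' + sigma_tilde \<kappa>y s2 x' x * fst z)"
    by (intro Bochner_Integration.integrable_add integrable_mult_right P.integrable_const fst)
  then show ?thesis
    unfolding next_value_eq
  proof (rule Bochner_Integration.integrable_bound)
    show "AE z in std_normal \<Otimes>\<^sub>M innovations K.
        norm ((\<mu>y x' + sigma_tilde \<kappa>y s2 x' x * fst z) * next_feas K \<mu>c \<kappa>c x (snd z) x')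
        \<le> norm (\<mu>y x' + sigma_tilde \<kappa>y s2 x' x * fst z)"
      unfolding real_norm_def abs_mult abs_of_nonneg[OF next_feas_bounds(1)]
      by (intro always_eventually allI mult_left_le next_feas_bounds abs_ge_zero)
  qed measurable
qed

lemma integrable_Max:
  fixes g :: "'a \<Rightarrow> 'b \<Rightarrow> real"
  assumes "finite X" "X \<noteq> {}" "\<And>x. x \<in> X \<Longrightarrow> integrable M (g x)"
  shows "integrable M (\<lambda>z. Max ((\<lambda>x. g x z) ` X))"
  using assms
proof (induction X rule: finite_ne_induct)
  case (insert x X)
  then have "integrable M (\<lambda>z. max (g x z) (Max ((\<lambda>x. g x z) ` X)))"
    by (intro integrable_max) auto
  then show ?case using insert by simp
qed simp

text \<open>Since r belongs to X, the integrand is nonnegative, and an integral of 0 forces it to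
  vanish almost everywhere.\<close>

lemma cKG_zero_AE:
  assumes X: "finite X" "r \<in> X" and zero: "cKG X K s2 \<mu>y \<kappa>y \<mu>c \<kappa>c r x = 0"
  shows "AE z in std_normal \<Otimes>\<^sub>M innovations K. \<forall>x'\<in>X.
    next_value K s2 \<mu>y \<kappa>y \<mu>c \<kappa>c x (fst z) (snd z) x' \<le> next_value K s2 \<mu>y \<kappa>y \<mu>c \<kappa>c x (fst z) (snd z) r"
proof -
  let ?v = "\<lambda>x' z. next_value K s2 \<mu>y \<kappa>y \<mu>c \<kappa>c x (fst z) (snd z) x'"
  have "integrable (std_normal \<Otimes>\<^sub>M innovations K) (\<lambda>z. Max ((\<lambda>x'. ?v x' z) ` X) - ?v r z)"
    using X by (intro Bochner_Integration.integrable_diff integrable_Max integrable_next_value) auto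
  moreover have nn: "Max ((\<lambda>x'. ?v x' z) ` X) - ?v r z \<ge> 0" for z
    using X by simp
  ultimately have "AE z in std_normal \<Otimes>\<^sub>M innovations K. Max ((\<lambda>x'. ?v x' z) ` X) - ?v r z = 0"
    using zero unfolding cKG_def by (subst (asm) integral_nonneg_eq_0_iff_AE) auto
  then show ?thesis
  proof eventually_elim
    case (elim z)
    show ?case
    proof
      fix x' assume "x' \<in> X"
      then have "?v x' z \<le> Max ((\<lambda>x'. ?v x' z) ` X)" using X by (intro Max_ge) auto
      then show "?v x' z \<le> ?v r z" using elim by simp
    qed
  qed
qed

text \<open>Letting the innovation of the objective tend to plus and minus infinity shows that after a
  sample of zero cKG, all utilities have the same slope in that innovation.\<close>

lemma cKG_zero_slopes:
  assumes X: "finite X" "r \<in> X" and zero: "cKG X K s2 \<mu>y \<kappa>y \<mu>c \<kappa>c r x = 0"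
  shows "AE zc in innovations K. \<forall>x'\<in>X.
    sigma_tilde \<kappa>y s2 x' x * next_feas K \<mu>c \<kappa>c x zc x' = sigma_tilde \<kappa>y s2 r x * next_feas K \<mu>c \<kappa>c x zc r"
proof -
  interpret N: prob_space std_normal by (rule prob_space_std_normal)
  interpret I: prob_space "innovations K" by (rule prob_space_innovations)
  interpret P: pair_prob_space std_normal "innovations K" ..
  define Q where "Q = (\<lambda>zy zc. \<forall>x'\<in>X. next_value K s2 \<mu>y \<kappa>y \<mu>c \<kappa>c x zy zc x' \<le> next_value K s2 \<mu>y \<kappa>y \<mu>c \<kappa>c x zy zc r)"
  have AE: "AE zy in std_normal. AE zc in innovations K. Q zy zc"
    using P.AE_pair[OF cKG_zero_AE[OF X zero]] by (simp add: Q_def)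
  \<comment> \<open>Only countably many values of \<open>zy\<close> are picked, so that one null set
    of constraint innovations serves them all.\<close>
  have "\<forall>j::nat. \<exists>z\<ge>real j. AE zc in innovations K. Q z zc"
    using AE_std_normal_unbounded(1)[OF AE] by blast
  then obtain u where u: "\<And>j::nat. u j \<ge> real j" "\<And>j. AE zc in innovations K. Q (u j) zc" by metis
  have "\<forall>j::nat. \<exists>z\<le>- real j. AE zc in innovations K. Q z zc"
    using AE_std_normal_unbounded(2)[OF AE] by blast
  then obtain l where l: "\<And>j::nat. l j \<le> - real j" "\<And>j. AE zc in innovations K. Q (l j) zc" by metis
  have "AE zc in innovations K. \<forall>j. Q (u j) zc \<and> Q (l j) zc"
    using u l by (simp add: AE_all_countable)
  then show ?thesis
  proof eventually_elim
    case (elim zc)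
    show ?case
    proof (intro ballI antisym)
      fix x' assume x': "x' \<in> X"
      let ?P = "next_feas K \<mu>c \<kappa>c x zc" and ?s = "\<lambda>x'. sigma_tilde \<kappa>y s2 x' x"
      have Q: "\<mu>y x' * ?P x' + (?s x' * ?P x') * z \<le> \<mu>y r * ?P r + (?s r * ?P r) * z" if "Q z zc" for z
        using that x' by (simp add: Q_def next_value_eq algebra_simps)
      show "?s x' * ?P x' \<le> ?s r * ?P r"
        by (rule slopes_le[where a = "\<mu>y x' * ?P x'" and c = "\<mu>y r * ?P r"]) (use Q u(1) elim in blast)
      have "- (?s x' * ?P x') \<le> - (?s r * ?P r)"
      proof (rule slopes_le[where a = "\<mu>y x' * ?P x'" and c = "\<mu>y r * ?P r"])
        fix j
        show "\<exists>z\<ge>real j. \<mu>y x' * ?P x' + - (?s x' * ?P x') * z \<le> \<mu>y r * ?P r + - (?s r * ?P r) * z"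
          by (rule exI[of _ "- l j"]) (use Q[of "l j"] l(1)[of j] elim in simp)
      qed
      then show "?s r * ?P r \<le> ?s x' * ?P x'" by simp
    qed
  qed
qed

text \<open>The slope at s is 0, hence so is the slope at x, which is a positive multiple of the
  updated probability of feasibility there.\<close>

lemma cKG_zero_imp_next_infeasible:
  assumes X: "finite X" "r \<in> X" "x \<in> X" "s \<in> X" and zero: "cKG X K s2 \<mu>y \<kappa>y \<mu>c \<kappa>c r x = 0"
    and s: "\<kappa>y s x = 0" and x: "\<kappa>y x x > 0" and s2: "s2 \<ge> 0"
  shows "AE zc in innovations K. next_feas K \<mu>c \<kappa>c x zc x = 0"
  using cKG_zero_slopes[OF X(1,2) zero]
proof eventually_elim
  case (elim zc)
  have "sigma_tilde \<kappa>y s2 x x * next_feas K \<mu>c \<kappa>c x zc x = sigma_tilde \<kappa>y s2 s x * next_feas K \<mu>c \<kappa>c x zc s"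
    using elim X(3,4) by metis
  then have "sigma_tilde \<kappa>y s2 x x * next_feas K \<mu>c \<kappa>c x zc x = 0"
    using s by (simp add: sigma_tilde_def)
  moreover have "sigma_tilde \<kappa>y s2 x x > 0"
    using x s2 by (simp add: sigma_tilde_def)
  ultimately show ?case by simp
qed

text \<open>A noise-free sample at x leaves no variance in the constraints at x. All of them come
  out satisfied on a box of innovations, whose probability is a product of positive factors.\<close>

lemma not_AE_next_infeasible:
  assumes "\<And>k. k \<in> {1..K} \<Longrightarrow> \<kappa>c k x x > 0"
  shows "\<not> (AE zc in innovations K. next_feas K \<mu>c \<kappa>c x zc x = 0)"
proof
  assume AE: "AE zc in innovations K. next_feas K \<mu>c \<kappa>c x zc x = 0"
  interpret N: prob_space std_normal by (rule prob_space_std_normal)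
  interpret PN: product_sigma_finite "\<lambda>_::nat. std_normal" ..
  \<comment> \<open>The endpoint is the innovation at which the updated mean of constraint k at x is
    0.\<close>
  define B where "B = (\<lambda>k. {..- \<mu>c k x / sqrt (\<kappa>c k x x)})"
  have feas: "next_feas K \<mu>c \<kappa>c x zc x = 1" if "zc \<in> PiE {1..K} B" for zc
    unfolding next_feas_def prob_feas_def
  proof (rule prod.neutral, rule ballI)
    fix k assume k: "k \<in> {1..K}"
    have s: "sigma_tilde (\<kappa>c k) 0 x x = sqrt (\<kappa>c k x x)"
      by (simp add: sigma_tilde_def real_div_sqrt less_imp_le[OF assms[OF k]])
    have "zc k \<in> B k" using that k by blast
    then have "\<mu>c k x + sqrt (\<kappa>c k x x) * zc k \<le> 0"
      using assms[OF k] by (simp add: B_def field_simps)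
    then show "measure (gauss (\<mu>c k x + sigma_tilde (\<kappa>c k) 0 x x * zc k)
        (\<kappa>c k x x - (sigma_tilde (\<kappa>c k) 0 x x)\<^sup>2)) {..0} = 1"
      using assms[OF k] by (simp add: s measure_gauss_point)
  qed
  from AE have "AE zc in innovations K. zc \<notin> PiE {1..K} B"
    by eventually_elim (use feas in fastforce)
  then have "emeasure (innovations K) (PiE {1..K} B) = 0"
    by (subst (asm) AE_iff_measurable[where N = "PiE {1..K} B"])
      (auto simp: B_def space_PiM intro!: sets_PiM_I_finite dest: PiE_mem)
  moreover have "emeasure (innovations K) (PiE {1..K} B) = (\<Prod>k\<in>{1..K}. emeasure std_normal (B k))"
    by (rule PN.emeasure_PiM) (auto simp: B_def)
  moreover have pos: "emeasure std_normal (B k) > 0" for k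
    by (rule emeasure_std_normal_pos[of "- \<mu>c k x / sqrt (\<kappa>c k x x) - 1" "- \<mu>c k x / sqrt (\<kappa>c k x x)"])
      (auto simp: B_def)
  ultimately have "(\<Prod>k\<in>{1..K}. emeasure std_normal (B k)) = 0" by (simp only:)
  then obtain k where "emeasure std_normal (B k) = 0" by auto
  with pos[of k] show False by (simp only: less_irrefl)
qed

section \<open>The limiting recommendation\<close>

lemma argmax_set_cong:
  assumes "\<And>x. x \<in> S \<Longrightarrow> g x = h x"
  shows "argmax_set S g = argmax_set S h"
  using assms by (auto simp: argmax_set_def is_arg_max_def)

text \<open>The argument along a single sample path: the noise enters only through its averages, and
  the remaining randomness is that of the innovations inside \<open>cKG\<close>.\<close>

lemma limit_utility_eq:
  fixes X :: "'a set" and K :: nat and s2 :: real and xs :: "nat \<Rightarrow> 'a" and \<epsilon> :: "nat \<Rightarrow> real"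
    and f \<mu>y0 :: "'a \<Rightarrow> real" and \<kappa>y0 :: "'a \<Rightarrow> 'a \<Rightarrow> real"
    and c \<mu>c0 :: "nat \<Rightarrow> 'a \<Rightarrow> real" and \<kappa>c0 :: "nat \<Rightarrow> 'a \<Rightarrow> 'a \<Rightarrow> real"
  defines "\<mu>y \<equiv> (\<lambda>x. lim (\<lambda>n. post_mean \<mu>y0 \<kappa>y0 s2 n xs (\<lambda>i. f (xs i) + \<epsilon> i) x))"
    and "\<kappa>y \<equiv> (\<lambda>x x'. lim (\<lambda>n. post_cov \<kappa>y0 s2 n xs x x'))"
    and "\<mu>c \<equiv> (\<lambda>k x. lim (\<lambda>n. post_mean (\<mu>c0 k) (\<kappa>c0 k) 0 n xs (\<lambda>i. c k (xs i)) x))"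
    and "\<kappa>c \<equiv> (\<lambda>k x x'. lim (\<lambda>n. post_cov (\<kappa>c0 k) 0 n xs x x'))"
  assumes X: "finite X" and s2: "s2 \<ge> 0" and xs: "\<And>i. xs i \<in> X"
    and pos_y: "pos_def_kernel X \<kappa>y0"
    and pos_c: "\<And>k. k \<in> {1..K} \<Longrightarrow> pos_def_kernel X (\<kappa>c0 k)"
    and no_noise: "s2 = 0 \<Longrightarrow> \<forall>i. \<epsilon> i = 0"
    and lln: "\<And>t. s2 > 0 \<Longrightarrow> t \<in> X \<Longrightarrow> infinite {i. xs i = t} \<Longrightarrow>
      (\<lambda>n. (\<Sum>i | i < n \<and> xs i = t. \<epsilon> i) / visits xs n t) \<longlonglongrightarrow> 0"
    and r: "r \<in> X"
    and zero: "\<And>x. x \<in> X \<Longrightarrow> cKG X K s2 \<mu>y \<kappa>y \<mu>c \<kappa>c r x = 0"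
    and x: "x \<in> X"
  shows "\<mu>y x * prob_feas K \<mu>c (\<lambda>k x. \<kappa>c k x x) x = f x * indicator {x \<in> X. \<forall>k\<in>{1..K}. c k x \<le> 0} x"
proof -
  interpret Y: gp_regression X \<kappa>y0 s2 xs
    by unfold_locales (use X s2 xs pos_y in auto)
  have C: "gp_regression X (\<kappa>c0 k) 0 xs" if "k \<in> {1..K}" for k
    by unfold_locales (use X xs pos_c[OF that] in auto)
  obtain s where s: "s \<in> X" "Y.known s" using Y.exists_known by blast
  have infeasible: "AE zc in innovations K. next_feas K \<mu>c \<kappa>c x zc x = 0" if not_known: "\<not> Y.known x"
  proof (rule cKG_zero_imp_next_infeasible[OF X r x s(1) zero[OF x] _ _ s2])
    show "\<kappa>y s x = 0"
      unfolding \<kappa>y_def by (rule limI[OF Y.post_cov_tendsto_0[OF s x]])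
    show "\<kappa>y x x > 0"
      unfolding \<kappa>y_def by (rule Y.lim_post_cov_diag_pos[OF x not_known])
  qed
  \<comment> \<open>An unsampled x is uncertain in the objective and in every constraint. Its
    updated probability of feasibility would be almost surely 0, yet it is positive with positive
    probability.\<close>
  have visited: "\<exists>i. xs i = x"
  proof (rule ccontr)
    assume not_visited: "\<nexists>i. xs i = x"
    then have "\<not> Y.known x" by (auto simp: Y.known_def)
    moreover have "\<kappa>c k x x > 0" if k: "k \<in> {1..K}" for k
      unfolding \<kappa>c_def using not_visited
      by (intro gp_regression.lim_post_cov_diag_pos[OF C[OF k] x])
        (simp add: gp_regression.known_noise_free[OF C[OF k]])
    ultimately show False using infeasible not_AE_next_infeasible[of K \<kappa>c x \<mu>c] by blast
  qed
  \<comment> \<open>Constraint values are observed without noise, so one visit determines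
    them.\<close>
  have c: "\<mu>c k x = c k x" "\<kappa>c k x x = 0" if k: "k \<in> {1..K}" for k
  proof -
    interpret C: gp_regression X "\<kappa>c0 k" 0 xs by (rule C[OF k])
    have known: "C.known x" using visited C.known_noise_free by blast
    show "\<kappa>c k x x = 0"
      unfolding \<kappa>c_def by (rule limI[OF C.post_cov_diag_tendsto_0[OF x known]])
    show "\<mu>c k x = c k x"
      unfolding \<mu>c_def
      using C.post_mean_tendsto[OF x known, of "\<lambda>_. 0" "\<mu>c0 k" "c k"] by (simp add: limI)
  qed
  have feas: "(\<Prod>k=1..K. measure (gauss (c k x) 0) {..0}) = indicator {x \<in> X. \<forall>k\<in>{1..K}. c k x \<le> 0} x"
  proof (cases "\<forall>k\<in>{1..K}. c k x \<le> 0")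
    case True
    then show ?thesis using x by (simp add: measure_gauss_point)
  next
    case False
    then obtain k where k: "k \<in> {1..K}" "\<not> c k x \<le> 0" by blast
    then have "measure (gauss (c k x) 0) {..0} = 0" by (simp add: measure_gauss_point)
    with k have "(\<Prod>k=1..K. measure (gauss (c k x) 0) {..0}) = 0"
      by (intro prod_zero) auto
    then show ?thesis using False by simp
  qed
  have PF: "prob_feas K \<mu>c (\<lambda>k x. \<kappa>c k x x) x = indicator {x \<in> X. \<forall>k\<in>{1..K}. c k x \<le> 0} x"
    unfolding feas[symmetric] prob_feas_def by (intro prod.cong refl) (simp add: c)
  show ?thesis
  proof (cases "x \<in> {x \<in> X. \<forall>k\<in>{1..K}. c k x \<le> 0}")
    case True
    \<comment> \<open>The constraint variances at x are 0, so \<open>sigma_tilde\<close> is 0 / 0,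
      read as 0, and a further sample at x changes nothing about its feasibility.\<close>
    have "next_feas K \<mu>c \<kappa>c x zc x = 1" for zc
    proof -
      have "next_feas K \<mu>c \<kappa>c x zc x = (\<Prod>k=1..K. measure (gauss (c k x) 0) {..0})"
        unfolding next_feas_def prob_feas_def
        by (intro prod.cong refl) (simp add: c sigma_tilde_def)
      then show ?thesis using True by (simp only: feas indicator_simps)
    qed
    then have "Y.known x"
      using infeasible prob_space.AE_const[OF prob_space_innovations] by fastforce
    then have "\<mu>y x = f x"
      unfolding \<mu>y_def using lln no_noise
      by (intro limI Y.post_mean_tendsto[OF x]) (auto simp: Y.agg_def)
    then show ?thesis by (simp only: PF)
  next
    case False
    show ?thesis unfolding PF indicator_simps(2)[OF False] by simp
  qed
qed

theorem theorem2:
  fixes M :: "'w measure" and \<F> :: "nat \<Rightarrow> 'w measure"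
    and X :: "(real ^ 'd) set" and K n0 :: nat and s2 :: real
    and f :: "real ^ 'd \<Rightarrow> real" and c :: "nat \<Rightarrow> real ^ 'd \<Rightarrow> real"
    and \<mu>y0 :: "real ^ 'd \<Rightarrow> real" and \<kappa>y0 :: "real ^ 'd \<Rightarrow> real ^ 'd \<Rightarrow> real"
    and \<mu>c0 :: "nat \<Rightarrow> real ^ 'd \<Rightarrow> real" and \<kappa>c0 :: "nat \<Rightarrow> real ^ 'd \<Rightarrow> real ^ 'd \<Rightarrow> real"
    and \<epsilon> :: "nat \<Rightarrow> 'w \<Rightarrow> real" and xs xr :: "nat \<Rightarrow> 'w \<Rightarrow> real ^ 'd"
    and F :: "(real ^ 'd) set"
    and \<mu>y :: "nat \<Rightarrow> 'w \<Rightarrow> real ^ 'd \<Rightarrow> real"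
    and \<kappa>y :: "nat \<Rightarrow> 'w \<Rightarrow> real ^ 'd \<Rightarrow> real ^ 'd \<Rightarrow> real"
    and \<mu>c :: "nat \<Rightarrow> 'w \<Rightarrow> nat \<Rightarrow> real ^ 'd \<Rightarrow> real"
    and \<kappa>c :: "nat \<Rightarrow> 'w \<Rightarrow> nat \<Rightarrow> real ^ 'd \<Rightarrow> real ^ 'd \<Rightarrow> real"
    and PF :: "nat \<Rightarrow> 'w \<Rightarrow> real ^ 'd \<Rightarrow> real"
    and \<mu>y_inf :: "'w \<Rightarrow> real ^ 'd \<Rightarrow> real"
    and \<kappa>y_inf :: "'w \<Rightarrow> real ^ 'd \<Rightarrow> real ^ 'd \<Rightarrow> real"
    and \<mu>c_inf :: "'w \<Rightarrow> nat \<Rightarrow> real ^ 'd \<Rightarrow> real"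
    and \<kappa>c_inf :: "'w \<Rightarrow> nat \<Rightarrow> real ^ 'd \<Rightarrow> real ^ 'd \<Rightarrow> real"
    and PF_inf :: "'w \<Rightarrow> real ^ 'd \<Rightarrow> real"
  defines F_def: "F \<equiv> {x \<in> X. \<forall>k\<in>{1..K}. c k x \<le> 0}"
    and \<mu>y_def: "\<mu>y \<equiv> (\<lambda>n \<omega>. post_mean \<mu>y0 \<kappa>y0 s2 n (\<lambda>i. xs i \<omega>) (\<lambda>i. f (xs i \<omega>) + \<epsilon> i \<omega>))"
    and \<kappa>y_def: "\<kappa>y \<equiv> (\<lambda>n \<omega>. post_cov \<kappa>y0 s2 n (\<lambda>i. xs i \<omega>))"
    and \<mu>c_def: "\<mu>c \<equiv> (\<lambda>n \<omega> k. post_mean (\<mu>c0 k) (\<kappa>c0 k) 0 n (\<lambda>i. xs i \<omega>) (\<lambda>i. c k (xs i \<omega>)))"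
    and \<kappa>c_def: "\<kappa>c \<equiv> (\<lambda>n \<omega> k. post_cov (\<kappa>c0 k) 0 n (\<lambda>i. xs i \<omega>))"
    and PF_def: "PF \<equiv> (\<lambda>n \<omega>. prob_feas K (\<mu>c n \<omega>) (\<lambda>k x. \<kappa>c n \<omega> k x x))"
    and \<mu>y_inf_def: "\<mu>y_inf \<equiv> (\<lambda>\<omega> x. lim (\<lambda>n. \<mu>y n \<omega> x))"
    and \<kappa>y_inf_def: "\<kappa>y_inf \<equiv> (\<lambda>\<omega> x x'. lim (\<lambda>n. \<kappa>y n \<omega> x x'))"
    and \<mu>c_inf_def: "\<mu>c_inf \<equiv> (\<lambda>\<omega> k x. lim (\<lambda>n. \<mu>c n \<omega> k x))"
    and \<kappa>c_inf_def: "\<kappa>c_inf \<equiv> (\<lambda>\<omega> k x x'. lim (\<lambda>n. \<kappa>c n \<omega> k x x'))"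
    and PF_inf_def: "PF_inf \<equiv> (\<lambda>\<omega>. prob_feas K (\<mu>c_inf \<omega>) (\<lambda>k x. \<kappa>c_inf \<omega> k x x))"
  assumes "finite X" and "F \<noteq> {}" and "s2 \<ge> 0"
    \<comment> \<open>priors\<close>
    and "sq_exp_kernel \<kappa>y0" and "pos_def_kernel X \<kappa>y0"
    and "\<And>k. k \<in> {1..K} \<Longrightarrow> sq_exp_kernel (\<kappa>c0 k)"
    and "\<And>k. k \<in> {1..K} \<Longrightarrow> pos_def_kernel X (\<kappa>c0 k)"
    \<comment> \<open>independent Gaussian noise; designs are chosen from past information\<close>
    and "prob_space M" and "filtration (space M) \<F>" and "\<And>n. sets (\<F> n) \<subseteq> sets M"
    and "\<And>n. xs n \<in> measurable (\<F> n) (count_space X)"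
    and "\<And>n. \<epsilon> n \<in> borel_measurable (\<F> (Suc n))"
    and "\<And>n. distr M borel (\<epsilon> n) = gauss 0 s2"
    and "\<And>n. prob_space.indep_set M (sets (\<F> n)) {\<epsilon> n -` B \<inter> space M | B. B \<in> sets borel}"
    \<comment> \<open>after n0 initial samples, the policy selects the designs\<close>
    and "AE \<omega> in M. \<forall>n\<ge>n0. xr n \<omega> \<in> argmax_set X (\<lambda>x. \<mu>y n \<omega> x * PF n \<omega> x)"
    and "AE \<omega> in M. \<forall>n\<ge>n0. xs n \<omega> \<in>
           argmax_set X (cKG X K s2 (\<mu>y n \<omega>) (\<kappa>y n \<omega>) (\<mu>c n \<omega>) (\<kappa>c n \<omega>) (xr n \<omega>))"
  shows "AE \<omega> in M. \<forall>r \<in> argmax_set X (\<lambda>x. \<mu>y_inf \<omega> x * PF_inf \<omega> x).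
           (\<forall>x\<in>X. cKG X K s2 (\<mu>y_inf \<omega>) (\<kappa>y_inf \<omega>) (\<mu>c_inf \<omega>) (\<kappa>c_inf \<omega>) r x = 0) \<longrightarrow>
           argmax_set X (\<lambda>x. \<mu>y_inf \<omega> x * PF_inf \<omega> x) = argmax_set X (\<lambda>x. f x * indicator F x)"
proof -
  interpret M: prob_space M by fact
  interpret filtration "space M" \<F> by fact
  have xs_X: "xs i \<omega> \<in> X" if "\<omega> \<in> space M" for i \<omega>
    using measurable_space[OF \<open>\<And>n. xs n \<in> measurable (\<F> n) (count_space X)\<close>, of \<omega> i] that by (simp add: space_F)
  have no_noise: "AE \<omega> in M. s2 = 0 \<longrightarrow> (\<forall>i. \<epsilon> i \<omega> = 0)"
  proof (cases "s2 = 0")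
    case True
    \<comment> \<open>For variance 0 the law \<open>gauss 0 0\<close> is the point mass at
      0.\<close>
    have "AE \<omega> in M. \<epsilon> i \<omega> = 0" for i
    proof -
      have "\<epsilon> i \<in> borel_measurable M"
        using measurable_mono[of borel borel "\<F> (Suc i)" M] \<open>\<And>n. sets (\<F> n) \<subseteq> sets M\<close>[of "Suc i"]
          \<open>\<And>n. \<epsilon> n \<in> borel_measurable (\<F> (Suc n))\<close>[of i]
        by (auto simp: space_F subset_eq)
      moreover have "distr M borel (\<epsilon> i) = return borel 0"
        using \<open>\<And>n. distr M borel (\<epsilon> n) = gauss 0 s2\<close>[of i] True by (simp add: gauss_def)
      then have "AE e in distr M borel (\<epsilon> i). e = 0"
        unfolding \<open>distr M borel (\<epsilon> i) = return borel 0\<close> by (subst AE_return) auto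
      ultimately show ?thesis by (subst (asm) AE_distr_iff) auto
    qed
    then show ?thesis by (simp add: AE_all_countable)
  qed simp
  have lln: "AE \<omega> in M. s2 > 0 \<longrightarrow> (\<forall>t\<in>X. infinite {i. xs i \<omega> = t} \<longrightarrow>
      (\<lambda>n. (\<Sum>i | i < n \<and> xs i \<omega> = t. \<epsilon> i \<omega>) / visits (\<lambda>i. xs i \<omega>) n t) \<longlonglongrightarrow> 0)"
  proof (cases "s2 > 0")
    case True
    have "AE \<omega> in M. infinite {i. xs i \<omega> = t} \<longrightarrow>
      (\<lambda>n. (\<Sum>i | i < n \<and> xs i \<omega> = t. \<epsilon> i \<omega>) / visits (\<lambda>i. xs i \<omega>) n t) \<longlonglongrightarrow> 0" if t: "t \<in> X" for t
    proof -
      \<comment> \<open>The i-th design is known in \<open>\<F> i\<close>, before its noise is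
        drawn; this is the predictability that the law of large numbers requires.\<close>
      define A where "A = (\<lambda>i. {\<omega>\<in>space M. xs i \<omega> = t})"
      have "A i \<in> sets (\<F> i)" for i
      proof -
        have "A i = xs i -` {t} \<inter> space (\<F> i)" by (auto simp: A_def space_F)
        then show ?thesis
          using measurable_sets[OF \<open>\<And>n. xs n \<in> measurable (\<F> n) (count_space X)\<close>, of "{t}" i] t by simp
      qed
      then interpret N: sampled_noise M \<F> \<epsilon> s2 A
        by unfold_locales (use assms True in auto)
      show ?thesis
        using N.lln AE_space
      proof eventually_elim
        case (elim \<omega>)
        have A: "\<omega> \<in> A i \<longleftrightarrow> xs i \<omega> = t" for i using elim(2) by (simp add: A_def)
        show ?case
          using elim(1) visits_at_top[of "\<lambda>i. xs i \<omega>" t] by (simp add: A visits_def)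
      qed
    qed
    then show ?thesis using True \<open>finite X\<close> by (simp add: AE_finite_all)
  qed simp
  \<comment> \<open>The exceptional null set is fixed here, before r is chosen, so it serves every
    limiting recommendation.\<close>
  show ?thesis
    using no_noise lln AE_space
  proof eventually_elim
    case (elim \<omega>)
    show ?case
    proof (intro ballI impI)
      fix r
      assume r: "r \<in> argmax_set X (\<lambda>x. \<mu>y_inf \<omega> x * PF_inf \<omega> x)"
        and zero: "\<forall>x\<in>X. cKG X K s2 (\<mu>y_inf \<omega>) (\<kappa>y_inf \<omega>) (\<mu>c_inf \<omega>) (\<kappa>c_inf \<omega>) r x = 0"
      have rX: "r \<in> X" using r by (simp add: argmax_set_def is_arg_max_def)
      show "argmax_set X (\<lambda>x. \<mu>y_inf \<omega> x * PF_inf \<omega> x) = argmax_set X (\<lambda>x. f x * indicator F x)"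
      proof (rule argmax_set_cong)
        fix x assume x: "x \<in> X"
        show "\<mu>y_inf \<omega> x * PF_inf \<omega> x = f x * indicator F x"
          unfolding PF_inf_def \<mu>y_inf_def \<mu>y_def \<mu>c_inf_def \<mu>c_def \<kappa>c_inf_def \<kappa>c_def F_def
        proof (rule limit_utility_eq[where r = r and X = X and xs = "\<lambda>i. xs i \<omega>" and \<epsilon> = "\<lambda>i. \<epsilon> i \<omega>"])
          fix x assume "x \<in> X"
          then show "cKG X K s2
              (\<lambda>x. lim (\<lambda>n. post_mean \<mu>y0 \<kappa>y0 s2 n (\<lambda>i. xs i \<omega>) (\<lambda>i. f (xs i \<omega>) + \<epsilon> i \<omega>) x))
              (\<lambda>x x'. lim (\<lambda>n. post_cov \<kappa>y0 s2 n (\<lambda>i. xs i \<omega>) x x'))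
              (\<lambda>k x. lim (\<lambda>n. post_mean (\<mu>c0 k) (\<kappa>c0 k) 0 n (\<lambda>i. xs i \<omega>) (\<lambda>i. c k (xs i \<omega>)) x))
              (\<lambda>k x x'. lim (\<lambda>n. post_cov (\<kappa>c0 k) 0 n (\<lambda>i. xs i \<omega>) x x')) r x = 0"
            using zero unfolding \<mu>y_inf_def \<mu>y_def \<kappa>y_inf_def \<kappa>y_def \<mu>c_inf_def \<mu>c_def \<kappa>c_inf_def \<kappa>c_def by blast
        qed (use assms elim xs_X rX x in auto)
      qed
    qed
  qed
qed

end
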